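(* Let $G$ be an ample groupoid. If $G$ is inner exact and has the residual intersection property, then $C_r^*(G)$ has the ideal property (IP).
   Context: Groupoids are locally compact Hausdorff with continuous product and inversion; $G^{(0)}$ is the unit space, $r(g)=gg^{-1}$, $d(g)=g^{-1}g$. $G$ is étale if $r,d$ are local homeomorphisms, and ample if it is étale and $G^{(0)}$ is totally disconnected (equivalently, it has a basis of compact open bisections). $D\subseteq G^{(0)}$ is invariant if $d(g)\in D$ implies $r(g)\in D$; then $G_D=\{g\in G: d(g)\in D\}$ is a groupoid with unit space $D$. $C_r^*(G)$ is the reduced groupoid $C^*$-algebra, and $C_0(G^{(0)})\subseteq C_r^*(G)$ via extension by zero. Ideals are closed and two-sided. $G$ is inner exact if for every closed invariant $D\subseteq G^{(0)}$ the sequence $0\to C_r^*(G_{G^{(0)}\setminus D})\to C_r^*(G)\to C_r^*(G_D)\to 0$ (maps induced by extension by zero and by restriction) is exact. $G$ has the intersection property if $I\cap C_0(G^{(0)})\neq\{0\}$ for every non-zero ideal $I\subseteq C_r^*(G)$, and the residual intersection property if $G_D$ has the intersection property for every closed invariant $D\subseteq G^{(0)}$. A $C^*$-algebra has the ideal property (IP) if every closed two-sided ideal is generated (as an ideal) by its projections. *)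

theory Defs
  imports "HOL-Analysis.Analysis"
begin

section \<open>Topological groupoids\<close>

record 'g groupoid =
  gtop :: "'g topology"
  gcomp :: "('g \<times> 'g) set"
  gmult :: "'g \<Rightarrow> 'g \<Rightarrow> 'g"
  ginv :: "'g \<Rightarrow> 'g"

text \<open>The groupoid is the carrier of its topology; the operations are only meaningful on
  the carrier and on the set \<^term>\<open>gcomp G\<close> of composable pairs.\<close>

definition gcarrier :: "'g groupoid \<Rightarrow> 'g set"
  where "gcarrier G = topspace (gtop G)"

definition grng :: "'g groupoid \<Rightarrow> 'g \<Rightarrow> 'g"
  where "grng G g = gmult G g (ginv G g)"

definition gdom :: "'g groupoid \<Rightarrow> 'g \<Rightarrow> 'g"
  where "gdom G g = gmult G (ginv G g) g"

definition units :: "'g groupoid \<Rightarrow> 'g set"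
  where "units G = grng G ` gcarrier G"

definition unit_top :: "'g groupoid \<Rightarrow> 'g topology"
  where "unit_top G = subtopology (gtop G) (units G)"

text \<open>Hahn's axioms; they imply that a pair \<^term>\<open>(g, h)\<close> of elements is composable iff
  \<^term>\<open>gdom G g = grng G h\<close>.\<close>

locale algebraic_groupoid =
  fixes G :: "'g groupoid"
  assumes comp_carrier: "gcomp G \<subseteq> gcarrier G \<times> gcarrier G"
    and mult_closed: "(g, h) \<in> gcomp G \<Longrightarrow> gmult G g h \<in> gcarrier G"
    and inv_closed: "g \<in> gcarrier G \<Longrightarrow> ginv G g \<in> gcarrier G"
    and comp_left: "(g, h) \<in> gcomp G \<Longrightarrow> (h, k) \<in> gcomp G \<Longrightarrow> (gmult G g h, k) \<in> gcomp G"
    and comp_right: "(g, h) \<in> gcomp G \<Longrightarrow> (h, k) \<in> gcomp G \<Longrightarrow> (g, gmult G h k) \<in> gcomp G"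
    and mult_assoc: "(g, h) \<in> gcomp G \<Longrightarrow> (h, k) \<in> gcomp G
           \<Longrightarrow> gmult G (gmult G g h) k = gmult G g (gmult G h k)"
    and inv_inv: "g \<in> gcarrier G \<Longrightarrow> ginv G (ginv G g) = g"
    and comp_inv: "g \<in> gcarrier G \<Longrightarrow> (g, ginv G g) \<in> gcomp G"
    and inv_cancel_left: "(g, h) \<in> gcomp G \<Longrightarrow> gmult G (ginv G g) (gmult G g h) = h"
    and inv_cancel_right: "(g, h) \<in> gcomp G \<Longrightarrow> gmult G (gmult G g h) (ginv G h) = g"

locale topological_groupoid = algebraic_groupoid +
  assumes locally_compact: "locally_compact_space (gtop G)"
    and Hausdorff: "Hausdorff_space (gtop G)"
    and continuous_mult: "continuous_map (subtopology (prod_topology (gtop G) (gtop G)) (gcomp G))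
           (gtop G) (\<lambda>(g, h). gmult G g h)"
    and continuous_inv: "continuous_map (gtop G) (gtop G) (ginv G)"

definition local_homeomorphism :: "'a topology \<Rightarrow> 'b topology \<Rightarrow> ('a \<Rightarrow> 'b) \<Rightarrow> bool"
  where "local_homeomorphism X Y f \<longleftrightarrow>
    (\<forall>x \<in> topspace X. \<exists>U. openin X U \<and> x \<in> U \<and> openin Y (f ` U) \<and>
       homeomorphic_map (subtopology X U) (subtopology Y (f ` U)) f)"

locale etale_groupoid = topological_groupoid +
  assumes local_homeo_rng: "local_homeomorphism (gtop G) (unit_top G) (grng G)"
    and local_homeo_dom: "local_homeomorphism (gtop G) (unit_top G) (gdom G)"

definition totally_disconnected_space :: "'a topology \<Rightarrow> bool"
  where "totally_disconnected_space X \<longleftrightarrow>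
    (\<forall>x \<in> topspace X. connected_component_of_set X x = {x})"

locale ample_groupoid = etale_groupoid +
  assumes totally_disconnected_units: "totally_disconnected_space (unit_top G)"

definition invariant :: "'g groupoid \<Rightarrow> 'g set \<Rightarrow> bool"
  where "invariant G D \<longleftrightarrow> D \<subseteq> units G \<and> (\<forall>g \<in> gcarrier G. gdom G g \<in> D \<longrightarrow> grng G g \<in> D)"

definition reduction :: "'g groupoid \<Rightarrow> 'g set \<Rightarrow> 'g groupoid"
  where "reduction G D = (let S = {g \<in> gcarrier G. gdom G g \<in> D} in
    \<lparr>gtop = subtopology (gtop G) S, gcomp = gcomp G \<inter> S \<times> S, gmult = gmult G, ginv = ginv G\<rparr>)"


section \<open>Operators on square-summable functions\<close>

typedef 'a ell2 = "{f :: 'a \<Rightarrow> complex. (\<lambda>x. (cmod (f x))\<^sup>2) summable_on UNIV}"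
  morphisms ell2_apply Abs_ell2
  by (rule exI [of _ "\<lambda>_. 0"]) simp

setup_lifting type_definition_ell2

lemma ell2_eqI: "(\<And>x. ell2_apply f x = ell2_apply g x) \<Longrightarrow> f = g"
  by (simp add: ell2_apply_inject [symmetric] fun_eq_iff)

lemma ell2_summable_mult:
  fixes f g :: "'a \<Rightarrow> complex"
  assumes "(\<lambda>x. (cmod (f x))\<^sup>2) summable_on UNIV" "(\<lambda>x. (cmod (g x))\<^sup>2) summable_on UNIV"
  shows "(\<lambda>x. cmod (f x) * cmod (g x)) summable_on UNIV"
proof (rule summable_on_comparison_test)
  show "(\<lambda>x. (cmod (f x))\<^sup>2 + (cmod (g x))\<^sup>2) summable_on UNIV"
    by (intro summable_on_add assms)
  fix x
  have "2 * (cmod (f x) * cmod (g x)) \<le> (cmod (f x))\<^sup>2 + (cmod (g x))\<^sup>2"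
    using sum_squares_bound [of "cmod (f x)" "cmod (g x)"] by simp
  moreover have "0 \<le> cmod (f x) * cmod (g x)" by simp
  ultimately show "cmod (f x) * cmod (g x) \<le> (cmod (f x))\<^sup>2 + (cmod (g x))\<^sup>2" by linarith
qed simp

lemma ell2_summable_inner:
  fixes f g :: "'a \<Rightarrow> complex"
  assumes "(\<lambda>x. (cmod (f x))\<^sup>2) summable_on UNIV" "(\<lambda>x. (cmod (g x))\<^sup>2) summable_on UNIV"
  shows "(\<lambda>x. f x \<bullet> g x) summable_on UNIV"
proof -
  have "(\<lambda>x. norm (f x \<bullet> g x)) summable_on UNIV"
    by (rule summable_on_comparison_test [OF ell2_summable_mult [OF assms]])
      (simp_all add: Cauchy_Schwarz_ineq2)
  then show ?thesis
    by (rule abs_summable_summable)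
qed

instantiation ell2 :: (type) real_inner
begin

lift_definition zero_ell2 :: "'a ell2" is "\<lambda>_. 0" by simp

lift_definition uminus_ell2 :: "'a ell2 \<Rightarrow> 'a ell2" is "\<lambda>f x. - f x" by simp

lift_definition plus_ell2 :: "'a ell2 \<Rightarrow> 'a ell2 \<Rightarrow> 'a ell2" is "\<lambda>f g x. f x + g x"
proof -
  fix f g :: "'a \<Rightarrow> complex"
  assume "(\<lambda>x. (cmod (f x))\<^sup>2) summable_on UNIV" "(\<lambda>x. (cmod (g x))\<^sup>2) summable_on UNIV"
  then have "(\<lambda>x. 2 * (cmod (f x))\<^sup>2 + 2 * (cmod (g x))\<^sup>2) summable_on UNIV"
    by (intro summable_on_add summable_on_cmult_right)
  then show "(\<lambda>x. (cmod (f x + g x))\<^sup>2) summable_on UNIV"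
  proof (rule summable_on_comparison_test)
    fix x
    have "(cmod (f x + g x))\<^sup>2 \<le> (cmod (f x) + cmod (g x))\<^sup>2"
      by (simp add: norm_triangle_ineq power_mono)
    also have "\<dots> \<le> 2 * (cmod (f x))\<^sup>2 + 2 * (cmod (g x))\<^sup>2"
      using sum_squares_bound [of "cmod (f x)" "cmod (g x)"] by (simp add: power2_sum)
    finally show "(cmod (f x + g x))\<^sup>2 \<le> 2 * (cmod (f x))\<^sup>2 + 2 * (cmod (g x))\<^sup>2" .
  qed simp
qed

definition minus_ell2 :: "'a ell2 \<Rightarrow> 'a ell2 \<Rightarrow> 'a ell2"
  where "minus_ell2 f g = f + - g"

lift_definition scaleR_ell2 :: "real \<Rightarrow> 'a ell2 \<Rightarrow> 'a ell2" is "\<lambda>c f x. c *\<^sub>R f x"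
  by (simp add: power_mult_distrib summable_on_cmult_right)

text \<open>The real part of the usual complex inner product.\<close>
lift_definition inner_ell2 :: "'a ell2 \<Rightarrow> 'a ell2 \<Rightarrow> real" is "\<lambda>f g. \<Sum>\<^sub>\<infinity>x. f x \<bullet> g x" .

lift_definition norm_ell2 :: "'a ell2 \<Rightarrow> real" is "\<lambda>f. sqrt (\<Sum>\<^sub>\<infinity>x. (cmod (f x))\<^sup>2)" .

definition dist_ell2 :: "'a ell2 \<Rightarrow> 'a ell2 \<Rightarrow> real"
  where "dist_ell2 f g = norm (f - g)"

definition sgn_ell2 :: "'a ell2 \<Rightarrow> 'a ell2"
  where "sgn_ell2 f = inverse (norm f) *\<^sub>R f"

definition uniformity_ell2 :: "('a ell2 \<times> 'a ell2) filter"
  where "uniformity_ell2 = (INF e\<in>{0<..}. principal {(f, g). dist f g < e})"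

definition open_ell2 :: "'a ell2 set \<Rightarrow> bool"
  where "open_ell2 U \<longleftrightarrow> (\<forall>f\<in>U. eventually (\<lambda>(f', g). f' = f \<longrightarrow> g \<in> U) uniformity)"

instance
proof
  fix f g h :: "'a ell2" and a b :: real
  show "f + g + h = f + (g + h)" by transfer (simp add: add.assoc)
  show "f + g = g + f" by transfer (simp add: add.commute)
  show "0 + f = f" by transfer simp
  show "- f + f = 0" by transfer simp
  show "f - g = f + - g" by (fact minus_ell2_def)
  show "a *\<^sub>R (f + g) = a *\<^sub>R f + a *\<^sub>R g" by transfer (simp add: scaleR_add_right)
  show "(a + b) *\<^sub>R f = a *\<^sub>R f + b *\<^sub>R f" by transfer (simp add: scaleR_add_left)
  show "a *\<^sub>R b *\<^sub>R f = (a * b) *\<^sub>R f" by transfer simp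
  show "1 *\<^sub>R f = f" by transfer simp
  show "sgn f = inverse (norm f) *\<^sub>R f" by (fact sgn_ell2_def)
  show "dist f g = norm (f - g)" by (fact dist_ell2_def)
  show "(uniformity :: ('a ell2 \<times> 'a ell2) filter)
        = (INF e\<in>{0<..}. principal {(x, y). dist x y < e})" by (fact uniformity_ell2_def)
  show "open U \<longleftrightarrow> (\<forall>x\<in>U. eventually (\<lambda>(x', y). x' = x \<longrightarrow> y \<in> U) uniformity)"
    for U :: "'a ell2 set" by (fact open_ell2_def)
  show "f \<bullet> g = g \<bullet> f" by transfer (simp add: inner_commute)
  show "(f + g) \<bullet> h = f \<bullet> h + g \<bullet> h"
    by transfer (simp add: inner_add_left infsum_add ell2_summable_inner)
  show "(a *\<^sub>R f) \<bullet> g = a * (f \<bullet> g)"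
    by transfer (simp add: infsum_cmult_right')
  show "0 \<le> f \<bullet> f" by transfer (simp add: infsum_nonneg)
  show "f \<bullet> f = 0 \<longleftrightarrow> f = 0"
  proof transfer
    fix f :: "'a \<Rightarrow> complex"
    assume sf: "(\<lambda>x. (cmod (f x))\<^sup>2) summable_on UNIV"
    show "(\<Sum>\<^sub>\<infinity>x. f x \<bullet> f x) = 0 \<longleftrightarrow> f = (\<lambda>_. 0)"
    proof
      assume z: "(\<Sum>\<^sub>\<infinity>x. f x \<bullet> f x) = 0"
      have "f x \<bullet> f x = 0" for x
        by (rule nonneg_infsum_le_0D [where A = UNIV])
           (use z sf in \<open>auto intro: ell2_summable_inner\<close>)
      then show "f = (\<lambda>_. 0)" by auto
    qed simp
  qed
  show "norm f = sqrt (f \<bullet> f)"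
    by transfer (simp add: power2_norm_eq_inner)
qed

end

text \<open>Conjugate-linear in the first argument.\<close>
definition cinner :: "'a ell2 \<Rightarrow> 'a ell2 \<Rightarrow> complex"
  where "cinner \<xi> \<eta> = (\<Sum>\<^sub>\<infinity>x. cnj (ell2_apply \<xi> x) * ell2_apply \<eta> x)"

lift_definition scaleC :: "complex \<Rightarrow> 'a ell2 \<Rightarrow> 'a ell2" is "\<lambda>c f x. c * f x"
  by (simp add: norm_mult power_mult_distrib summable_on_cmult_right)

lemma norm_scaleC: "norm (scaleC c \<xi>) = cmod c * norm \<xi>"
  by transfer (simp add: norm_mult power_mult_distrib infsum_cmult_right' real_sqrt_mult)

lemma bounded_linear_scaleC: "bounded_linear (scaleC c)"
proof (rule bounded_linear_intro [where K = "cmod c"])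
  show "scaleC c (\<xi> + \<eta>) = scaleC c \<xi> + scaleC c \<eta>" for \<xi> \<eta> :: "'a ell2"
    by transfer (simp add: distrib_left)
  show "scaleC c (a *\<^sub>R \<xi>) = a *\<^sub>R scaleC c \<xi>" for a and \<xi> :: "'a ell2"
    by transfer simp
  show "norm (scaleC c \<xi>) \<le> norm \<xi> * cmod c" for \<xi> :: "'a ell2"
    by (simp add: norm_scaleC)
qed

type_synonym 'a operator = "'a ell2 \<Rightarrow>\<^sub>L 'a ell2"

definition scaleC_op :: "complex \<Rightarrow> 'a operator \<Rightarrow> 'a operator"
  where "scaleC_op c T = Blinfun (scaleC c) o\<^sub>L T"

definition is_adjoint :: "'a operator \<Rightarrow> 'a operator \<Rightarrow> bool"
  where "is_adjoint T S \<longleftrightarrow> (\<forall>\<xi> \<eta>. cinner (blinfun_apply T \<xi>) \<eta> = cinner \<xi> (blinfun_apply S \<eta>))"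

definition is_projection :: "'a operator \<Rightarrow> bool"
  where "is_projection P \<longleftrightarrow> P o\<^sub>L P = P \<and> is_adjoint P P"


section \<open>Concrete C*-algebras\<close>

text \<open>In this section \<^term>\<open>A\<close>, \<^term>\<open>B\<close>, \<^term>\<open>C\<close> stand for norm-closed *-subalgebras of
  the bounded operators.\<close>

definition closed_ideal :: "'a operator set \<Rightarrow> 'a operator set \<Rightarrow> bool"
  where "closed_ideal A I \<longleftrightarrow> I \<subseteq> A \<and> closed I \<and> 0 \<in> I \<and>
    (\<forall>S\<in>I. \<forall>T\<in>I. S + T \<in> I) \<and> (\<forall>c. \<forall>T\<in>I. scaleC_op c T \<in> I) \<and>
    (\<forall>S\<in>A. \<forall>T\<in>I. S o\<^sub>L T \<in> I \<and> T o\<^sub>L S \<in> I)"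

definition ideal_property :: "'a operator set \<Rightarrow> bool"
  where "ideal_property A \<longleftrightarrow>
    (\<forall>I. closed_ideal A I \<longrightarrow> (closed_ideal A) hull {P \<in> I. is_projection P} = I)"

definition star_hom :: "'a operator set \<Rightarrow> 'b operator set \<Rightarrow> ('a operator \<Rightarrow> 'b operator) \<Rightarrow> bool"
  where "star_hom A B \<phi> \<longleftrightarrow> \<phi> ` A \<subseteq> B \<and>
    (\<forall>S\<in>A. \<forall>T\<in>A. \<phi> (S + T) = \<phi> S + \<phi> T \<and> \<phi> (S o\<^sub>L T) = \<phi> S o\<^sub>L \<phi> T) \<and>
    (\<forall>c. \<forall>T\<in>A. \<phi> (scaleC_op c T) = scaleC_op c (\<phi> T)) \<and>
    (\<forall>S\<in>A. \<forall>T\<in>A. is_adjoint S T \<longrightarrow> is_adjoint (\<phi> S) (\<phi> T))"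

definition short_exact :: "'a operator set \<Rightarrow> 'b operator set \<Rightarrow> 'c operator set \<Rightarrow>
    ('a operator \<Rightarrow> 'b operator) \<Rightarrow> ('b operator \<Rightarrow> 'c operator) \<Rightarrow> bool"
  where "short_exact A B C \<phi> \<psi> \<longleftrightarrow>
    inj_on \<phi> A \<and> \<phi> ` A = {T \<in> B. \<psi> T = 0} \<and> \<psi> ` B = C"


section \<open>The reduced groupoid C*-algebra\<close>

text \<open>Functions on the groupoid, or on its unit space, are represented by their extension by
  zero to the whole type, so extension by zero is the identity on representatives.\<close>

definition Cc :: "'g groupoid \<Rightarrow> ('g \<Rightarrow> complex) set"
  where "Cc G = {f. continuous_map (gtop G) euclidean f \<and>
    compactin (gtop G) (gtop G closure_of {g \<in> gcarrier G. f g \<noteq> 0}) \<and>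
    (\<forall>g. g \<notin> gcarrier G \<longrightarrow> f g = 0)}"

definition C0_units :: "'g groupoid \<Rightarrow> ('g \<Rightarrow> complex) set"
  where "C0_units G = {f. continuous_map (unit_top G) euclidean f \<and>
    (\<forall>e>0. compactin (unit_top G) {x \<in> units G. e \<le> cmod (f x)}) \<and>
    (\<forall>g. g \<notin> units G \<longrightarrow> f g = 0)}"

text \<open>The direct sum over all units \<^term>\<open>x\<close> of the left regular representations
  \<^term>\<open>\<pi>\<^sub>x\<close> on the square-summable functions on the fibre of \<^term>\<open>gdom G\<close> over \<^term>\<open>x\<close>,
  \<open>(\<pi>\<^sub>x f \<xi>) g = (\<Sum>h | gdom G h = x. f (g h\<^sup>-\<^sup>1) \<xi> h)\<close>.
  The fibres partition the carrier, so the sum acts on the square-summable functions on the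
  carrier; off the carrier the operator is zero. If \<^term>\<open>G\<close> is etale, then the
  family of summands has finite support and the operator is bounded for all \<^term>\<open>f\<close> in
  \<^term>\<open>Cc G\<close> or \<^term>\<open>C0_units G\<close>. Its norm for \<^term>\<open>f\<close> in \<^term>\<open>Cc G\<close> is the reduced
  norm, the supremum over \<^term>\<open>x\<close> of the norms of \<^term>\<open>\<pi>\<^sub>x f\<close>.\<close>

definition reg_rep :: "'g groupoid \<Rightarrow> ('g \<Rightarrow> complex) \<Rightarrow> 'g operator"
  where "reg_rep G f = Blinfun (\<lambda>\<xi>. Abs_ell2 (\<lambda>g.
    if g \<in> gcarrier G
    then \<Sum>\<^sub>\<infinity>h\<in>{h \<in> gcarrier G. gdom G h = gdom G g}. f (gmult G g (ginv G h)) * ell2_apply \<xi> h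
    else 0))"

definition Cstar_red :: "'g groupoid \<Rightarrow> 'g operator set"
  where "Cstar_red G = closure (reg_rep G ` Cc G)"

text \<open>The copy of \<^term>\<open>C0_units G\<close> inside \<^term>\<open>Cstar_red G\<close>.\<close>
definition diagonal :: "'g groupoid \<Rightarrow> 'g operator set"
  where "diagonal G = reg_rep G ` C0_units G"

text \<open>A continuous map on the reduced algebra is determined by its values on the image of
  \<^term>\<open>Cc G\<close>; hence the following two predicates determine \<^term>\<open>\<phi>\<close> and \<^term>\<open>\<psi>\<close>
  uniquely on the respective algebras.\<close>

definition extension_hom :: "'g groupoid \<Rightarrow> 'g set \<Rightarrow> ('g operator \<Rightarrow> 'g operator) \<Rightarrow> bool"
  where "extension_hom G U \<phi> \<longleftrightarrow>
    star_hom (Cstar_red (reduction G U)) (Cstar_red G) \<phi> \<and>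
    continuous_on (Cstar_red (reduction G U)) \<phi> \<and>
    (\<forall>f \<in> Cc (reduction G U). \<phi> (reg_rep (reduction G U) f) = reg_rep G f)"

definition restriction_hom :: "'g groupoid \<Rightarrow> 'g set \<Rightarrow> ('g operator \<Rightarrow> 'g operator) \<Rightarrow> bool"
  where "restriction_hom G D \<psi> \<longleftrightarrow>
    star_hom (Cstar_red G) (Cstar_red (reduction G D)) \<psi> \<and>
    continuous_on (Cstar_red G) \<psi> \<and>
    (\<forall>f \<in> Cc G. \<psi> (reg_rep G f) =
      reg_rep (reduction G D) (\<lambda>g. if g \<in> gcarrier (reduction G D) then f g else 0))"

definition inner_exact :: "'g groupoid \<Rightarrow> bool"
  where "inner_exact G \<longleftrightarrow>
    (\<forall>D. closedin (unit_top G) D \<and> invariant G D \<longrightarrow>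
      (\<exists>\<phi> \<psi>. extension_hom G (units G - D) \<phi> \<and> restriction_hom G D \<psi> \<and>
        short_exact (Cstar_red (reduction G (units G - D))) (Cstar_red G)
          (Cstar_red (reduction G D)) \<phi> \<psi>))"

definition intersection_property :: "'g groupoid \<Rightarrow> bool"
  where "intersection_property G \<longleftrightarrow>
    (\<forall>I. closed_ideal (Cstar_red G) I \<and> I \<noteq> {0} \<longrightarrow> I \<inter> diagonal G \<noteq> {0})"

definition residual_intersection_property :: "'g groupoid \<Rightarrow> bool"
  where "residual_intersection_property G \<longleftrightarrow>
    (\<forall>D. closedin (unit_top G) D \<and> invariant G D \<longrightarrow> intersection_property (reduction G D))"

end

theory Submission
  imports Defs
begin

text \<open>Let \<open>A = C\<^sub>r\<^sup>*(G)\<close>, let \<open>I\<close> be a closed ideal of \<open>A\<close> and \<open>J\<close> any closed ideal that contains the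
  projections of \<open>I\<close>. The claim is \<open>I \<subseteq> J\<close>. The indicator function \<open>1\<^sub>K\<close> of a compact open set \<open>K\<close> of
  units is a projection of \<open>A\<close>. Let \<open>U\<close> be the union of those \<open>K\<close> with \<open>1\<^sub>K \<in> I\<close>
  (\<open>ideal_support\<close>), and let \<open>D\<close> be the complement of \<open>U\<close> in the unit space. If \<open>B\<close> is a compact
  open bisection with \<open>r(B) \<subseteq> K\<close>, then \<open>1\<^bsub>B\<inverse>\<^esub> 1\<^sub>K 1\<^sub>B = 1\<^bsub>d(B)\<^esub>\<close>
  (\<open>bisection_conjugate\<close>); since such bisections form a basis of the topology, \<open>D\<close> is invariant.
  Let \<open>\<psi>\<close> be the restriction map from \<open>A\<close> to \<open>C\<^sub>r\<^sup>*(G\<^sub>D)\<close>.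

  The kernel of \<open>\<psi>\<close> is contained in \<open>J\<close>, and in \<open>I\<close> too, because \<open>I\<close> is one of the possible
  \<open>J\<close>. By exactness the kernel is the closure of the image of \<open>C\<^sub>c(G\<^sub>U)\<close>; if \<open>f\<close> lies in
  \<open>C\<^sub>c(G\<^sub>U)\<close>, then finitely many of the sets \<open>K\<close> cover the compact image of its support under \<open>d\<close>,
  and \<open>f = f 1\<^sub>L\<close> for their union \<open>L\<close>, where \<open>1\<^sub>L \<in> J\<close>
  (\<open>extension_image_subset\<close>).

  Conversely \<open>\<psi>\<close> vanishes on \<open>I\<close> (\<open>restriction_kills_ideal\<close>). Otherwise the closure of \<open>\<psi>(I)\<close> is
  a nonzero closed ideal and by the intersection property of \<open>G\<^sub>D\<close> it contains a nonzero \<open>f\<close> in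
  \<open>C\<^sub>0(D)\<close>. The unit space has a basis of compact open sets, so there is a compact open \<open>K\<close> that
  meets \<open>D\<close> and is such that \<open>f\<close> has no zero on \<open>K \<inter> D\<close>; multiplying by the inverse of \<open>f\<close> there puts
  \<open>1\<^bsub>K \<inter> D\<^esub>\<close> into the closure of \<open>\<psi>(I)\<close>. An idempotent in this closure already lies in
  \<open>\<psi>(I)\<close> (\<open>idempotent_in_closure_image\<close>), so \<open>1\<^bsub>K \<inter> D\<^esub> = \<psi>(b)\<close> with \<open>b \<in> I\<close>. As also
  \<open>1\<^bsub>K \<inter> D\<^esub> = \<psi>(1\<^sub>K)\<close>, the difference \<open>1\<^sub>K - b\<close> is in the kernel and hence in \<open>I\<close>. Then
  \<open>1\<^sub>K \<in> I\<close>, so \<open>K \<subseteq> U\<close>, although \<open>K\<close> meets \<open>D\<close>. Altogether \<open>I\<close> is contained in the kernel of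
  \<open>\<psi>\<close>, and so in \<open>J\<close>.

  Two facts carry the analysis. Matrices with bounded entries and a uniform bound on the number of
  nonzero entries in each row and column define bounded operators (\<open>finite_matrix_bounded\<close>); this
  gives access to the values of the regular representation. The Hilbert space is complete, which
  is what makes the step from the closure of \<open>\<psi>(I)\<close> to \<open>\<psi>(I)\<close> possible.\<close>

section \<open>Operators on square-summable functions\<close>

lemma ell2_apply_zero [simp]: "ell2_apply 0 x = 0"
  by transfer simp

lemma ell2_apply_add [simp]: "ell2_apply (\<xi> + \<eta>) x = ell2_apply \<xi> x + ell2_apply \<eta> x"
  by transfer simp

lemma ell2_apply_diff [simp]: "ell2_apply (\<xi> - \<eta>) x = ell2_apply \<xi> x - ell2_apply \<eta> x"
  unfolding minus_ell2_def by transfer simp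

lemma ell2_apply_scaleR [simp]: "ell2_apply (a *\<^sub>R \<xi>) x = a *\<^sub>R ell2_apply \<xi> x"
  by transfer simp

lemma ell2_apply_scaleC [simp]: "ell2_apply (scaleC c \<xi>) x = c * ell2_apply \<xi> x"
  by transfer simp

lemma ell2_summable: "(\<lambda>x. (cmod (ell2_apply \<xi> x))\<^sup>2) summable_on UNIV"
  using ell2_apply [of \<xi>] by simp

lemma ell2_norm_power2: "(norm \<xi>)\<^sup>2 = (\<Sum>\<^sub>\<infinity>x. (cmod (ell2_apply \<xi> x))\<^sup>2)"
  by transfer (simp add: infsum_nonneg)

lemma finite_sum_le_ell2_norm:
  assumes "finite F"
  shows "(\<Sum>x\<in>F. (cmod (ell2_apply \<xi> x))\<^sup>2) \<le> (norm \<xi>)\<^sup>2"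
  unfolding ell2_norm_power2
  by (rule finite_sum_le_infsum) (use assms ell2_summable in auto)

lemma ell2_apply_le_norm: "cmod (ell2_apply \<xi> x) \<le> norm \<xi>"
  by (rule power2_le_imp_le) (use finite_sum_le_ell2_norm [of "{x}" \<xi>] in auto)

text \<open>Square summability and the norm are tested on finite sets of indices, since all terms are
  nonnegative.\<close>
lemma ell2_from_finite_bound:
  assumes "\<And>F. finite F \<Longrightarrow> (\<Sum>x\<in>F. (cmod (f x))\<^sup>2) \<le> C\<^sup>2" and "0 \<le> C"
  shows "ell2_apply (Abs_ell2 f) = f" and "norm (Abs_ell2 f) \<le> C"
proof -
  have "(\<lambda>x. (cmod (f x))\<^sup>2) summable_on UNIV"
    by (rule nonneg_bdd_above_summable_on) (auto intro!: bdd_aboveI2 assms)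
  then show f: "ell2_apply (Abs_ell2 f) = f"
    by (simp add: Abs_ell2_inverse)
  have "(norm (Abs_ell2 f))\<^sup>2 \<le> C\<^sup>2"
    unfolding ell2_norm_power2 f
    by (rule infsum_le_finite_sums) (use assms \<open>(\<lambda>x. (cmod (f x))\<^sup>2) summable_on UNIV\<close> in auto)
  then show "norm (Abs_ell2 f) \<le> C"
    using \<open>0 \<le> C\<close> by (rule power2_le_imp_le)
qed

text \<open>The pointwise limit of a Cauchy sequence is the limit in norm: the bounds on finite partial sums
  survive the pointwise limit.\<close>
instance ell2 :: (type) banach
proof
  fix X :: "nat \<Rightarrow> 'a ell2"
  assume "Cauchy X"
  have "Cauchy (\<lambda>n. ell2_apply (X n) x)" for x
  proof (rule metric_CauchyI)
    fix e :: real assume "0 < e"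
    with \<open>Cauchy X\<close> obtain M where M: "\<And>m n. m \<ge> M \<Longrightarrow> n \<ge> M \<Longrightarrow> dist (X m) (X n) < e"
      by (meson metric_CauchyD)
    have "dist (ell2_apply (X m) x) (ell2_apply (X n) x) \<le> dist (X m) (X n)" for m n
      using ell2_apply_le_norm [of "X m - X n" x] by (simp add: dist_norm)
    with M show "\<exists>M. \<forall>m\<ge>M. \<forall>n\<ge>M. dist (ell2_apply (X m) x) (ell2_apply (X n) x) < e"
      by (meson le_less_trans)
  qed
  then obtain L where L: "\<And>x. (\<lambda>n. ell2_apply (X n) x) \<longlonglongrightarrow> L x"
    unfolding Cauchy_convergent_iff convergent_def by metis
  have bound: "(\<Sum>x\<in>F. (cmod (ell2_apply (X m) x - L x))\<^sup>2) \<le> e\<^sup>2"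
    if "\<And>n. n \<ge> M \<Longrightarrow> dist (X m) (X n) < e" "finite F" for F e M m
  proof (rule tendsto_upperbound)
    show "(\<lambda>n. \<Sum>x\<in>F. (cmod (ell2_apply (X m) x - ell2_apply (X n) x))\<^sup>2)
      \<longlonglongrightarrow> (\<Sum>x\<in>F. (cmod (ell2_apply (X m) x - L x))\<^sup>2)"
      by (intro tendsto_intros L)
    have "(\<Sum>x\<in>F. (cmod (ell2_apply (X m) x - ell2_apply (X n) x))\<^sup>2) \<le> e\<^sup>2" if "n \<ge> M" for n
    proof -
      have "(\<Sum>x\<in>F. (cmod (ell2_apply (X m) x - ell2_apply (X n) x))\<^sup>2) \<le> (norm (X m - X n))\<^sup>2"
        using finite_sum_le_ell2_norm [OF \<open>finite F\<close>, of "X m - X n"] by simp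
      also have "\<dots> \<le> e\<^sup>2"
        using \<open>\<And>n. n \<ge> M \<Longrightarrow> dist (X m) (X n) < e\<close> [OF that]
        by (intro power_mono) (auto simp: dist_norm)
      finally show ?thesis .
    qed
    then show "\<forall>\<^sub>F n in sequentially.
        (\<Sum>x\<in>F. (cmod (ell2_apply (X m) x - ell2_apply (X n) x))\<^sup>2) \<le> e\<^sup>2"
      by (auto simp: eventually_sequentially)
  qed simp
  \<comment> \<open>It is the difference of a term and the limit that is known to be small, so square
    summability of the limit itself is read off from \<open>X M0 - Y M0\<close>.\<close>
  define Y where "Y m = Abs_ell2 (\<lambda>x. ell2_apply (X m) x - L x)" for m
  have Y: "ell2_apply (Y m) = (\<lambda>x. ell2_apply (X m) x - L x)" "norm (Y m) \<le> e"
    if "\<And>n. n \<ge> M \<Longrightarrow> dist (X m) (X n) < e" "0 < e" for m M e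
    unfolding Y_def using ell2_from_finite_bound [OF bound [OF that(1)]] that(2) by auto
  obtain M0 where M0: "\<And>m n. m \<ge> M0 \<Longrightarrow> n \<ge> M0 \<Longrightarrow> dist (X m) (X n) < 1"
    using \<open>Cauchy X\<close> by (meson metric_CauchyD zero_less_one)
  define l where "l = X M0 - Y M0"
  have l: "ell2_apply l = L"
    unfolding l_def using Y(1) [of M0 M0 1] M0 by (auto simp: fun_eq_iff)
  have "X \<longlonglongrightarrow> l"
  proof (rule metric_LIMSEQ_I)
    fix e :: real assume "0 < e"
    then obtain M where M: "\<And>m n. m \<ge> M \<Longrightarrow> n \<ge> M \<Longrightarrow> dist (X m) (X n) < e / 2"
      using \<open>Cauchy X\<close> by (meson metric_CauchyD half_gt_zero)
    have "dist (X m) l < e" if "m \<ge> M" for m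
    proof -
      have "ell2_apply (Y m) = (\<lambda>x. ell2_apply (X m) x - L x)" "norm (Y m) \<le> e / 2"
        using Y [of M m "e/2"] M that \<open>0 < e\<close> by auto
      moreover from this have "X m - l = Y m"
        by (intro ell2_eqI) (simp add: l)
      ultimately show ?thesis
        using \<open>0 < e\<close> by (simp add: dist_norm)
    qed
    then show "\<exists>M. \<forall>m\<ge>M. dist (X m) l < e" by blast
  qed
  then show "convergent X"
    by (rule convergentI)
qed

text \<open>By the Cauchy-Schwarz inequality the row \<open>g\<close> contributes at most \<open>N M\<^sup>2\<close> times the sum of the
  \<open>|\<xi> h|\<^sup>2\<close> over the support of the row, and every \<open>h\<close> is in the support of at most \<open>N\<close> rows. So the norm is
  at most \<open>N M\<close>.\<close>
lemma finite_matrix_bounded: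
  fixes k :: "'a \<Rightarrow> 'a \<Rightarrow> complex"
  assumes bound: "\<And>g h. cmod (k g h) \<le> M"
    and row: "\<And>g. finite {h. k g h \<noteq> 0} \<and> card {h. k g h \<noteq> 0} \<le> N"
    and col: "\<And>h. finite {g. k g h \<noteq> 0} \<and> card {g. k g h \<noteq> 0} \<le> N"
  defines "T \<equiv> \<lambda>\<xi> g. \<Sum>h\<in>{h. k g h \<noteq> 0}. k g h * ell2_apply \<xi> h"
  shows "ell2_apply (Abs_ell2 (T \<xi>)) = T \<xi>"
    and "bounded_linear (\<lambda>\<xi>. Abs_ell2 (T \<xi>))"
proof -
  have M: "0 \<le> M"
    using bound [of undefined undefined] by (meson norm_ge_zero order_trans)
  have row_le: "(cmod (T \<xi> g))\<^sup>2 \<le> N * M\<^sup>2 * (\<Sum>h\<in>{h. k g h \<noteq> 0}. (cmod (ell2_apply \<xi> h))\<^sup>2)"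
    (is "_ \<le> _ * ?S") for \<xi> g
  proof -
    have "cmod (T \<xi> g) \<le> (\<Sum>h\<in>{h. k g h \<noteq> 0}. M * cmod (ell2_apply \<xi> h))"
      unfolding T_def using bound by (intro sum_norm_le) (simp add: norm_mult mult_right_mono)
    then have "(cmod (T \<xi> g))\<^sup>2 \<le> (\<Sum>h\<in>{h. k g h \<noteq> 0}. M * cmod (ell2_apply \<xi> h))\<^sup>2"
      by (intro power_mono) auto
    also have "\<dots> \<le> (\<Sum>h\<in>{h. k g h \<noteq> 0}. M\<^sup>2) * ?S"
      by (rule Cauchy_Schwarz_ineq_sum)
    also have "\<dots> = card {h. k g h \<noteq> 0} * M\<^sup>2 * ?S" by simp
    also have "\<dots> \<le> N * M\<^sup>2 * ?S"
      using row [of g] by (intro mult_right_mono) (auto intro: sum_nonneg)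
    finally show ?thesis .
  qed
  have "(\<Sum>g\<in>F. (cmod (T \<xi> g))\<^sup>2) \<le> (N * M * norm \<xi>)\<^sup>2" if F: "finite F" for \<xi> F
  proof -
    let ?H = "\<Union>g\<in>F. {h. k g h \<noteq> 0}"
    have H: "finite ?H" using F row by auto
    have "(\<Sum>g\<in>F. \<Sum>h\<in>{h. k g h \<noteq> 0}. (cmod (ell2_apply \<xi> h))\<^sup>2)
        = (\<Sum>g\<in>F. \<Sum>h\<in>?H. if k g h \<noteq> 0 then (cmod (ell2_apply \<xi> h))\<^sup>2 else 0)"
    proof (rule sum.cong [OF refl])
      fix g assume "g \<in> F"
      then have "?H \<inter> {h. k g h \<noteq> 0} = {h. k g h \<noteq> 0}" by auto
      with sum.inter_restrict [OF H, of "\<lambda>h. (cmod (ell2_apply \<xi> h))\<^sup>2" "{h. k g h \<noteq> 0}"]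
      show "(\<Sum>h\<in>{h. k g h \<noteq> 0}. (cmod (ell2_apply \<xi> h))\<^sup>2)
        = (\<Sum>h\<in>?H. if k g h \<noteq> 0 then (cmod (ell2_apply \<xi> h))\<^sup>2 else 0)" by simp
    qed
    also have "\<dots> = (\<Sum>h\<in>?H. \<Sum>g\<in>F. if k g h \<noteq> 0 then (cmod (ell2_apply \<xi> h))\<^sup>2 else 0)"
      by (rule sum.swap)
    also have "\<dots> = (\<Sum>h\<in>?H. card {g\<in>F. k g h \<noteq> 0} * (cmod (ell2_apply \<xi> h))\<^sup>2)"
      using F by (simp flip: sum.inter_filter)
    also have "\<dots> \<le> (\<Sum>h\<in>?H. N * (cmod (ell2_apply \<xi> h))\<^sup>2)"
    proof (intro sum_mono mult_right_mono)
      fix h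
      have "card {g\<in>F. k g h \<noteq> 0} \<le> card {g. k g h \<noteq> 0}"
        using col [of h] by (intro card_mono) auto
      with col [of h] show "real (card {g\<in>F. k g h \<noteq> 0}) \<le> real N" by simp
    qed simp
    also have "\<dots> \<le> N * (norm \<xi>)\<^sup>2"
      using finite_sum_le_ell2_norm [OF H, of \<xi>] by (simp flip: sum_distrib_left add: mult_left_mono)
    finally have "(\<Sum>g\<in>F. \<Sum>h\<in>{h. k g h \<noteq> 0}. (cmod (ell2_apply \<xi> h))\<^sup>2) \<le> N * (norm \<xi>)\<^sup>2" .
    then have "N * M\<^sup>2 * (\<Sum>g\<in>F. \<Sum>h\<in>{h. k g h \<noteq> 0}. (cmod (ell2_apply \<xi> h))\<^sup>2)
        \<le> N * M\<^sup>2 * (N * (norm \<xi>)\<^sup>2)"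
      by (intro mult_left_mono) auto
    moreover have "(\<Sum>g\<in>F. (cmod (T \<xi> g))\<^sup>2)
        \<le> N * M\<^sup>2 * (\<Sum>g\<in>F. \<Sum>h\<in>{h. k g h \<noteq> 0}. (cmod (ell2_apply \<xi> h))\<^sup>2)"
      unfolding sum_distrib_left [of _ _ F] by (rule sum_mono) (rule row_le)
    ultimately show ?thesis
      by (simp add: power2_eq_square mult_ac)
  qed
  note fin = this
  show apply_T: "ell2_apply (Abs_ell2 (T \<xi>)) = T \<xi>" for \<xi>
    by (rule ell2_from_finite_bound(1) [OF fin]) (use M in auto)
  show "bounded_linear (\<lambda>\<xi>. Abs_ell2 (T \<xi>))"
  proof (rule bounded_linear_intro)
    show "Abs_ell2 (T (\<xi> + \<eta>)) = Abs_ell2 (T \<xi>) + Abs_ell2 (T \<eta>)" for \<xi> \<eta>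
      by (rule ell2_eqI) (simp add: apply_T, simp add: T_def distrib_left sum.distrib)
    show "Abs_ell2 (T (a *\<^sub>R \<xi>)) = a *\<^sub>R Abs_ell2 (T \<xi>)" for a \<xi>
      by (rule ell2_eqI) (simp add: apply_T, simp add: T_def scaleR_sum_right)
    show "norm (Abs_ell2 (T \<xi>)) \<le> norm \<xi> * (N * M)" for \<xi>
      using ell2_from_finite_bound(2) [OF fin] M by (simp add: mult.commute)
  qed
qed

text \<open>The equation \<open>y = p + p (p - q) y\<close> has a solution in \<open>L\<close> because its right-hand side is a
  contraction. A solution satisfies \<open>p y = y\<close>, hence \<open>y = p + y - p q y\<close>, which is the claim. This is the
  Neumann series for the inverse of \<open>p q p\<close> in the corner of \<open>p\<close>, summed inside \<open>L\<close>.\<close>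
lemma idempotent_near_left_ideal:
  fixes p q :: "'a::banach \<Rightarrow>\<^sub>L 'a"
  assumes L: "closed L" and p: "p \<in> L" "p o\<^sub>L p = p"
    and near: "norm p * norm (p - q) < 1"
    and step: "\<And>y. y \<in> L \<Longrightarrow> p + (p o\<^sub>L (p - q) o\<^sub>L y) \<in> L"
  shows "\<exists>y\<in>L. p = p o\<^sub>L q o\<^sub>L y"
proof -
  define f :: "('a \<Rightarrow>\<^sub>L 'a) \<Rightarrow> _" where "f y = p + (p o\<^sub>L (p - q) o\<^sub>L y)" for y
  have "\<exists>!y\<in>L. f y = y"
  proof (rule Banach_fix [where c = "norm p * norm (p - q)"])
    show "complete L" using L by (simp add: complete_eq_closed)
    show "f ` L \<subseteq> L" using step by (auto simp: f_def)
    show "dist (f x) (f y) \<le> norm p * norm (p - q) * dist x y" for x y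
    proof -
      have "f x - f y = (p o\<^sub>L (p - q)) o\<^sub>L (x - y)"
        by (rule blinfun_eqI) (simp add: f_def blinfun.diff_left blinfun.add_left blinfun.diff_right)
      then have "dist (f x) (f y) \<le> norm (p o\<^sub>L (p - q)) * norm (x - y)"
        by (simp add: dist_norm norm_blinfun_compose)
      also have "\<dots> \<le> norm p * norm (p - q) * norm (x - y)"
        by (intro mult_right_mono norm_blinfun_compose) simp
      finally show ?thesis by (simp add: dist_norm)
    qed
  qed (use p near in auto)
  then obtain y where y: "y \<in> L" "f y = y" by blast
  have pp: "p (p x) = p x" for x
    using p(2) by (metis blinfun_apply_blinfun_compose)
  have fy: "y x = p x + p (p (y x)) - p (q (y x))" for x
    using arg_cong [OF y(2), of "\<lambda>z. blinfun_apply z x"]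
    by (simp only: f_def blinfun_apply_blinfun_compose blinfun.diff_left blinfun.add_left
        blinfun.diff_right add_diff_eq)
  have py: "p (y x) = y x" for x
  proof -
    have "p (y x) = p (p x + p (p (y x)) - p (q (y x)))"
      by (rule arg_cong [OF fy])
    also have "\<dots> = p x + p (p (y x)) - p (q (y x))"
      by (simp add: pp blinfun.diff_right blinfun.add_right)
    finally show ?thesis by (simp only: fy [symmetric])
  qed
  have "p x = p (q (y x))" for x
    using fy [of x] unfolding pp py by (simp add: algebra_simps)
  then have "p = p o\<^sub>L q o\<^sub>L y"
    by (intro blinfun_eqI) simp
  with y(1) show ?thesis by blast
qed

section \<open>Algebra of groupoids\<close>

context algebraic_groupoid
begin

lemma comp_inv_left: "g \<in> gcarrier G \<Longrightarrow> (ginv G g, g) \<in> gcomp G"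
  using comp_inv [of "ginv G g"] inv_closed inv_inv by simp

lemma grng_inv [simp]: "g \<in> gcarrier G \<Longrightarrow> grng G (ginv G g) = gdom G g"
  by (simp add: grng_def gdom_def inv_inv)

lemma gdom_inv [simp]: "g \<in> gcarrier G \<Longrightarrow> gdom G (ginv G g) = grng G g"
  by (simp add: grng_def gdom_def inv_inv)

lemma grng_mult_self: "g \<in> gcarrier G \<Longrightarrow> gmult G (grng G g) g = g"
  using inv_cancel_right [OF comp_inv] by (simp add: grng_def inv_inv)

lemma comp_gdom_eq_grng:
  assumes "(g, h) \<in> gcomp G" shows "gdom G g = grng G h"
proof -
  have car: "g \<in> gcarrier G" "h \<in> gcarrier G" using assms comp_carrier by auto
  have "gmult G (gdom G g) h = h"
    using mult_assoc [OF comp_inv_left assms] car inv_cancel_left [OF assms] by (simp add: gdom_def)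
  moreover have "(gdom G g, h) \<in> gcomp G"
    unfolding gdom_def using comp_left [OF comp_inv_left assms] car by simp
  ultimately show ?thesis
    using inv_cancel_right [of "gdom G g" h] by (simp add: grng_def)
qed

text \<open>For the common unit \<open>e = d(g) = r(h)\<close> both \<open>(g, e)\<close> and \<open>(e, h)\<close> are composable, hence so is
  \<open>(g, e h)\<close>, and \<open>e h = h\<close>.\<close>
lemma comp_if_gdom_eq_grng:
  assumes "g \<in> gcarrier G" "h \<in> gcarrier G" "gdom G g = grng G h"
  shows "(g, h) \<in> gcomp G"
proof -
  have "(g, gdom G g) \<in> gcomp G"
    unfolding gdom_def by (rule comp_right [OF comp_inv comp_inv_left]) (use assms in auto)
  moreover have "(grng G h, h) \<in> gcomp G"
    unfolding grng_def by (rule comp_left [OF comp_inv comp_inv_left]) (use assms in auto)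
  ultimately have "(g, gmult G (grng G h) h) \<in> gcomp G"
    using assms comp_right by simp
  then show ?thesis using assms by (simp add: grng_mult_self)
qed

lemma comp_iff: "(g, h) \<in> gcomp G \<longleftrightarrow> g \<in> gcarrier G \<and> h \<in> gcarrier G \<and> gdom G g = grng G h"
  using comp_gdom_eq_grng comp_if_gdom_eq_grng comp_carrier by blast

lemma grng_mult:
  assumes "(g, h) \<in> gcomp G" shows "grng G (gmult G g h) = grng G g"
proof -
  have "g \<in> gcarrier G" using assms comp_carrier by auto
  then have "(ginv G g, gmult G g h) \<in> gcomp G"
    using comp_right [OF comp_inv_left assms] by simp
  with \<open>g \<in> gcarrier G\<close> show ?thesis by (simp add: comp_iff)
qed

lemma gdom_mult:
  assumes "(g, h) \<in> gcomp G" shows "gdom G (gmult G g h) = gdom G h"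
proof -
  have "h \<in> gcarrier G" using assms comp_carrier by auto
  then have "(gmult G g h, ginv G h) \<in> gcomp G"
    using comp_left [OF assms comp_inv] by simp
  with \<open>h \<in> gcarrier G\<close> show ?thesis by (simp add: comp_iff)
qed

lemma grng_in_units: "g \<in> gcarrier G \<Longrightarrow> grng G g \<in> units G"
  by (simp add: units_def)

lemma gdom_in_units: "g \<in> gcarrier G \<Longrightarrow> gdom G g \<in> units G"
  using grng_in_units [OF inv_closed] by simp

lemma units_carrier: "x \<in> units G \<Longrightarrow> x \<in> gcarrier G"
  using mult_closed comp_inv by (auto simp: units_def grng_def)

lemma grng_unit: "x \<in> units G \<Longrightarrow> grng G x = x"
  using grng_mult [OF comp_inv] by (auto simp: units_def grng_def)

lemma gdom_unit: "x \<in> units G \<Longrightarrow> gdom G x = x"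
proof (clarsimp simp: units_def)
  fix g assume g: "g \<in> gcarrier G"
  have "gdom G (gmult G g (ginv G g)) = gdom G (ginv G g)"
    by (rule gdom_mult [OF comp_inv [OF g]])
  with g show "gdom G (grng G g) = grng G g" by (simp add: grng_def)
qed

text \<open>The kernel of the regular representation is evaluated at \<open>g h\<^sup>-\<^sup>1\<close>. The last two identities make
  the passage to this quotient an injective change of variables, both for fixed \<open>h\<close> and for fixed \<open>g\<close>.\<close>
lemma quotient:
  assumes "g \<in> gcarrier G" "h \<in> gcarrier G" "gdom G g = gdom G h"
  shows quotient_carrier: "gmult G g (ginv G h) \<in> gcarrier G"
    and grng_quotient: "grng G (gmult G g (ginv G h)) = grng G g"
    and gdom_quotient: "gdom G (gmult G g (ginv G h)) = grng G h"
    and quotient_mult: "gmult G (gmult G g (ginv G h)) h = g"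
    and quotient_inv_mult: "gmult G (ginv G (gmult G g (ginv G h))) g = h"
proof -
  have comp: "(g, ginv G h) \<in> gcomp G"
    using assms by (simp add: comp_iff inv_closed)
  show q: "gmult G g (ginv G h) \<in> gcarrier G" by (rule mult_closed [OF comp])
  show "grng G (gmult G g (ginv G h)) = grng G g" by (rule grng_mult [OF comp])
  show d: "gdom G (gmult G g (ginv G h)) = grng G h" using gdom_mult [OF comp] assms by simp
  show m: "gmult G (gmult G g (ginv G h)) h = g"
    using inv_cancel_right [OF comp] assms by (simp add: inv_inv)
  show "gmult G (ginv G (gmult G g (ginv G h))) g = h"
    using inv_cancel_left [of "gmult G g (ginv G h)" h] q d m assms by (simp add: comp_iff)
qed

lemma quotient_self: "h \<in> gcarrier G \<Longrightarrow> gmult G h (ginv G h) = grng G h"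
  by (simp add: grng_def)

text \<open>This is why functions on the unit space act diagonally in the regular representation.\<close>
lemma quotient_unit_imp_eq:
  assumes "g \<in> gcarrier G" "h \<in> gcarrier G" "gdom G g = gdom G h" "gmult G g (ginv G h) \<in> units G"
  shows "g = h"
  using quotient [OF assms(1-3)] gdom_unit [OF assms(4)] grng_mult_self [OF assms(2)] by simp

end

lemma reduction_simps [simp]:
  "gtop (reduction G D) = subtopology (gtop G) {g \<in> gcarrier G. gdom G g \<in> D}"
  "gcarrier (reduction G D) = {g \<in> gcarrier G. gdom G g \<in> D}"
  "gmult (reduction G D) = gmult G" "ginv (reduction G D) = ginv G"
  "grng (reduction G D) = grng G" "gdom (reduction G D) = gdom G"
  by (auto simp: reduction_def Let_def gcarrier_def grng_def gdom_def fun_eq_iff)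

lemma gcomp_reduction:
  "gcomp (reduction G D) = gcomp G \<inter> gcarrier (reduction G D) \<times> gcarrier (reduction G D)"
  unfolding reduction_simps by (simp add: reduction_def Let_def)

context algebraic_groupoid
begin

lemma units_reduction: 
  assumes "invariant G D" shows "units (reduction G D) = D"
proof
  show "units (reduction G D) \<subseteq> D" using assms by (auto simp: units_def invariant_def)
  show "D \<subseteq> units (reduction G D)"
  proof
    fix x assume "x \<in> D"
    then have "x \<in> units G" using assms by (auto simp: invariant_def)
    with \<open>x \<in> D\<close> show "x \<in> units (reduction G D)"
      unfolding units_def [of "reduction G D"]
      by (intro image_eqI [where x = x]) (auto simp: grng_unit gdom_unit units_carrier)
  qed
qed

lemma algebraic_groupoid_reduction:
  assumes "invariant G D" shows "algebraic_groupoid (reduction G D)"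
proof
  have D: "grng G g \<in> D" if "g \<in> gcarrier G" "gdom G g \<in> D" for g
    using assms that by (auto simp: invariant_def)
  fix g h k
  show "gcomp (reduction G D) \<subseteq> gcarrier (reduction G D) \<times> gcarrier (reduction G D)"
    by (auto simp: gcomp_reduction)
  show "gmult (reduction G D) g h \<in> gcarrier (reduction G D)" if "(g, h) \<in> gcomp (reduction G D)"
    using that by (auto simp: gcomp_reduction mult_closed gdom_mult)
  show "ginv (reduction G D) g \<in> gcarrier (reduction G D)" if "g \<in> gcarrier (reduction G D)"
    using that D by (auto simp: inv_closed)
  show "ginv (reduction G D) (ginv (reduction G D) g) = g" if "g \<in> gcarrier (reduction G D)"
    using that by (auto simp: inv_inv)
  show "(g, ginv (reduction G D) g) \<in> gcomp (reduction G D)" if "g \<in> gcarrier (reduction G D)"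
    using that D by (auto simp: gcomp_reduction inv_closed comp_inv)
  show "gmult (reduction G D) (ginv (reduction G D) g) (gmult (reduction G D) g h) = h"
    "gmult (reduction G D) (gmult (reduction G D) g h) (ginv (reduction G D) h) = g"
    if "(g, h) \<in> gcomp (reduction G D)"
    using that by (auto simp: gcomp_reduction inv_cancel_left inv_cancel_right)
  assume gh: "(g, h) \<in> gcomp (reduction G D)" and hk: "(h, k) \<in> gcomp (reduction G D)"
  then have "(g, h) \<in> gcomp G" "(h, k) \<in> gcomp G" by (auto simp: gcomp_reduction)
  then show "gmult (reduction G D) (gmult (reduction G D) g h) k
      = gmult (reduction G D) g (gmult (reduction G D) h k)"
    by (simp add: mult_assoc)
  show "(gmult (reduction G D) g h, k) \<in> gcomp (reduction G D)"
    using gh hk comp_left [of g h k] by (auto simp: gcomp_reduction mult_closed gdom_mult)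
  show "(g, gmult (reduction G D) h k) \<in> gcomp (reduction G D)"
    using gh hk comp_right [of g h k] by (auto simp: gcomp_reduction mult_closed gdom_mult)
qed

end

section \<open>The regular representation\<close>

definition fibre_bounded :: "'g groupoid \<Rightarrow> nat \<Rightarrow> 'g set \<Rightarrow> bool"
  where "fibre_bounded G N S \<longleftrightarrow> (\<forall>x.
    finite {g \<in> S. grng G g = x} \<and> card {g \<in> S. grng G g = x} \<le> N \<and>
    finite {g \<in> S. gdom G g = x} \<and> card {g \<in> S. gdom G g = x} \<le> N)"

text \<open>For these functions the kernel \<open>f (g h\<^sup>-\<^sup>1)\<close> of the regular representation is a matrix with boundedly
  many nonzero entries in each row and column. The notion covers both the functions in \<^const>\<open>Cc\<close> of
  an etale groupoid and the bounded functions on the unit space, and it is stated without topology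
  so that, for functions on the unit space, the groupoid axioms are enough.\<close>
definition representable :: "'g groupoid \<Rightarrow> ('g \<Rightarrow> complex) \<Rightarrow> bool"
  where "representable G f \<longleftrightarrow> (\<exists>M. \<forall>g. cmod (f g) \<le> M) \<and>
    (\<exists>N S. S \<subseteq> gcarrier G \<and> fibre_bounded G N S \<and> (\<forall>g. g \<notin> S \<longrightarrow> f g = 0))"

context algebraic_groupoid
begin

text \<open>For fixed \<open>g\<close> the map \<open>h \<mapsto> g h\<^sup>-\<^sup>1\<close> is injective with values in the fibre of \<open>r\<close> over \<open>r(g)\<close>; for fixed
  \<open>h\<close> the map \<open>g \<mapsto> g h\<^sup>-\<^sup>1\<close> is injective with values in the fibre of \<open>d\<close> over \<open>r(h)\<close>.\<close>
lemma quotient_fibres: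
  assumes N: "fibre_bounded G N S"
  shows "g \<in> gcarrier G \<Longrightarrow> finite {h \<in> gcarrier G. gdom G h = gdom G g \<and> gmult G g (ginv G h) \<in> S}
      \<and> card {h \<in> gcarrier G. gdom G h = gdom G g \<and> gmult G g (ginv G h) \<in> S} \<le> N"
    and "h \<in> gcarrier G \<Longrightarrow> finite {g \<in> gcarrier G. gdom G h = gdom G g \<and> gmult G g (ginv G h) \<in> S}
      \<and> card {g \<in> gcarrier G. gdom G h = gdom G g \<and> gmult G g (ginv G h) \<in> S} \<le> N"
proof -
  have inj_card: "finite A \<and> card A \<le> N"
    if "inj_on \<phi> A" "\<phi> ` A \<subseteq> B" "finite B" "card B \<le> N" for \<phi> :: "'g \<Rightarrow> 'g" and A B
    using that card_inj_on_le inj_on_finite order_trans by metis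
  {
    assume g: "g \<in> gcarrier G"
    show "finite {h \<in> gcarrier G. gdom G h = gdom G g \<and> gmult G g (ginv G h) \<in> S}
      \<and> card {h \<in> gcarrier G. gdom G h = gdom G g \<and> gmult G g (ginv G h) \<in> S} \<le> N"
    proof (rule inj_card [where \<phi> = "\<lambda>h. gmult G g (ginv G h)" and B = "{b \<in> S. grng G b = grng G g}"])
      show "inj_on (\<lambda>h. gmult G g (ginv G h))
        {h \<in> gcarrier G. gdom G h = gdom G g \<and> gmult G g (ginv G h) \<in> S}"
        by (rule inj_on_inverseI [where g = "\<lambda>b. gmult G (ginv G b) g"])
          (use g in \<open>auto simp: quotient_inv_mult\<close>)
    qed (use N g in \<open>auto simp: fibre_bounded_def grng_quotient\<close>)
  next
    assume h: "h \<in> gcarrier G"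
    show "finite {g \<in> gcarrier G. gdom G h = gdom G g \<and> gmult G g (ginv G h) \<in> S}
      \<and> card {g \<in> gcarrier G. gdom G h = gdom G g \<and> gmult G g (ginv G h) \<in> S} \<le> N"
    proof (rule inj_card [where \<phi> = "\<lambda>g. gmult G g (ginv G h)" and B = "{b \<in> S. gdom G b = grng G h}"])
      show "inj_on (\<lambda>g. gmult G g (ginv G h))
        {g \<in> gcarrier G. gdom G h = gdom G g \<and> gmult G g (ginv G h) \<in> S}"
        by (rule inj_on_inverseI [where g = "\<lambda>b. gmult G b h"])
          (use h in \<open>auto simp: quotient_mult\<close>)
    qed (use N h in \<open>auto simp: fibre_bounded_def gdom_quotient\<close>)
  }
qed

lemma representable_finite_fibre:
  assumes "representable G f" "g \<in> gcarrier G"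
  shows "finite {h \<in> gcarrier G. gdom G h = gdom G g \<and> f (gmult G g (ginv G h)) \<noteq> 0}"
proof -
  obtain N S where "fibre_bounded G N S" "\<forall>g. g \<notin> S \<longrightarrow> f g = 0"
    using assms by (auto simp: representable_def)
  with quotient_fibres(1) [of N S g] assms show ?thesis
    by (auto elim!: rev_finite_subset)
qed

text \<open>The defining formula of \<^const>\<open>reg_rep\<close> is a statement about its values only once its right-hand
  side is known to be square summable and bounded in \<open>\<xi>\<close>; both come from the matrix bound.\<close>
lemma reg_rep_apply:
  assumes "representable G f"
  shows "ell2_apply (reg_rep G f \<xi>) g = (if g \<in> gcarrier G
    then \<Sum>\<^sub>\<infinity>h\<in>{h \<in> gcarrier G. gdom G h = gdom G g}. f (gmult G g (ginv G h)) * ell2_apply \<xi> h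
    else 0)" (is "_ = ?R \<xi> g")
proof -
  obtain M N S where M: "\<And>g. cmod (f g) \<le> M" and S: "S \<subseteq> gcarrier G"
    and N: "fibre_bounded G N S" and f0: "\<And>g. g \<notin> S \<Longrightarrow> f g = 0"
    using assms by (auto simp: representable_def)
  define k where "k g h = (if g \<in> gcarrier G \<and> h \<in> gcarrier G \<and> gdom G h = gdom G g
      then f (gmult G g (ginv G h)) else 0)" for g h
  have sub: "finite A \<and> card A \<le> n" if "finite B \<and> card B \<le> n" "A \<subseteq> B" for A B :: "'g set" and n
    using that by (meson card_mono finite_subset order_trans)
  have 1: "cmod (k g h) \<le> M" for g h
    using M [of "gmult G g (ginv G h)"] order_trans [OF norm_ge_zero M] by (auto simp: k_def)
  have 2: "finite {h. k g h \<noteq> 0} \<and> card {h. k g h \<noteq> 0} \<le> N" for g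
  proof (cases "g \<in> gcarrier G")
    case True
    show ?thesis
      by (rule sub [OF quotient_fibres(1) [OF N True]])
        (use f0 in \<open>auto simp: k_def split: if_splits\<close>)
  qed (simp add: k_def)
  have 3: "finite {g. k g h \<noteq> 0} \<and> card {g. k g h \<noteq> 0} \<le> N" for h
  proof (cases "h \<in> gcarrier G")
    case True
    show ?thesis
      by (rule sub [OF quotient_fibres(2) [OF N True]])
        (use f0 in \<open>auto simp: k_def split: if_splits\<close>)
  qed (simp add: k_def)
  have eq: "?R \<xi> = (\<lambda>g. \<Sum>h\<in>{h. k g h \<noteq> 0}. k g h * ell2_apply \<xi> h)" for \<xi>
  proof
    fix g
    show "?R \<xi> g = (\<Sum>h\<in>{h. k g h \<noteq> 0}. k g h * ell2_apply \<xi> h)"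
    proof (cases "g \<in> gcarrier G")
      case True
      have "(\<Sum>\<^sub>\<infinity>h\<in>{h \<in> gcarrier G. gdom G h = gdom G g}. f (gmult G g (ginv G h)) * ell2_apply \<xi> h)
          = (\<Sum>\<^sub>\<infinity>h\<in>{h. k g h \<noteq> 0}. k g h * ell2_apply \<xi> h)"
        by (rule infsum_cong_neutral) (use True in \<open>auto simp: k_def split: if_splits\<close>)
      with True 2 [of g] show ?thesis by simp
    qed (simp add: k_def)
  qed
  note T = finite_matrix_bounded [of k, OF 1 2 3]
  have "bounded_linear (\<lambda>\<xi>. Abs_ell2 (?R \<xi>))"
    unfolding eq by (rule T(2))
  then have "reg_rep G f \<xi> = Abs_ell2 (?R \<xi>)"
    unfolding reg_rep_def by (simp add: bounded_linear_Blinfun_apply)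
  then have "ell2_apply (reg_rep G f \<xi>) = ?R \<xi>"
    by (simp only: eq T(1))
  then show ?thesis by (rule fun_cong)
qed

lemma reg_rep_apply_outside:
  "representable G f \<Longrightarrow> g \<notin> gcarrier G \<Longrightarrow> ell2_apply (reg_rep G f \<xi>) g = 0"
  by (simp add: reg_rep_apply)

lemma operator_eqI:
  fixes S T :: "'b operator"
  assumes "\<And>\<xi> g. ell2_apply (S \<xi>) g = ell2_apply (T \<xi>) g"
  shows "S = T"
  by (intro blinfun_eqI ell2_eqI assms)

lemma reg_rep_add:
  assumes f: "representable G f" and f': "representable G f'" and s: "representable G (\<lambda>g. f g + f' g)"
  shows "reg_rep G (\<lambda>g. f g + f' g) = reg_rep G f + reg_rep G f'"
proof (rule operator_eqI)
  fix \<xi> g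
  show "ell2_apply (reg_rep G (\<lambda>g. f g + f' g) \<xi>) g = ell2_apply ((reg_rep G f + reg_rep G f') \<xi>) g"
  proof (cases "g \<in> gcarrier G")
    case True
    have summable: "(\<lambda>h. u (gmult G g (ginv G h)) * ell2_apply \<xi> h)
        summable_on {h \<in> gcarrier G. gdom G h = gdom G g}" if "representable G u" for u
      by (rule finite_nonzero_values_imp_summable_on)
        (use representable_finite_fibre [OF that True] in \<open>auto elim!: rev_finite_subset\<close>)
    from True show ?thesis
      by (simp add: blinfun.add_left reg_rep_apply assms distrib_right
          infsum_add [OF summable [OF f] summable [OF f']])
  qed (simp add: blinfun.add_left reg_rep_apply_outside assms)
qed

lemma representable_units:
  assumes "\<And>g. g \<notin> units G \<Longrightarrow> f g = 0" "\<And>g. cmod (f g) \<le> M"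
  shows "representable G f"
proof -
  have "{g \<in> units G. grng G g = x} \<subseteq> {x}" "{g \<in> units G. gdom G g = x} \<subseteq> {x}" for x
    by (auto simp: grng_unit gdom_unit)
  moreover have "finite A \<and> card A \<le> 1" if "A \<subseteq> {x}" for A and x :: 'g
    using that card_mono [of "{x}" A] finite_subset [of A "{x}"] by simp
  ultimately have "fibre_bounded G 1 (units G)"
    unfolding fibre_bounded_def by blast
  with assms show ?thesis
    unfolding representable_def using units_carrier by blast
qed

lemma reg_rep_units_apply:
  assumes "\<And>g. g \<notin> units G \<Longrightarrow> f g = 0" "\<And>g. cmod (f g) \<le> M"
  shows "ell2_apply (reg_rep G f \<xi>) g = (if g \<in> gcarrier G then f (grng G g) * ell2_apply \<xi> g else 0)"
proof (cases "g \<in> gcarrier G")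
  case True
  have "(\<Sum>\<^sub>\<infinity>h\<in>{h \<in> gcarrier G. gdom G h = gdom G g}. f (gmult G g (ginv G h)) * ell2_apply \<xi> h)
      = (\<Sum>\<^sub>\<infinity>h\<in>{g}. f (grng G g) * ell2_apply \<xi> g)"
  proof (rule infsum_cong_neutral)
    fix h assume h: "h \<in> {h \<in> gcarrier G. gdom G h = gdom G g} - {g}"
    then have "gmult G g (ginv G h) \<notin> units G"
      using quotient_unit_imp_eq [of g h] True by auto
    then show "f (gmult G g (ginv G h)) * ell2_apply \<xi> h = 0"
      by (simp add: assms(1))
  qed (use True in \<open>auto simp: quotient_self\<close>)
  with True show ?thesis
    using reg_rep_apply [OF representable_units, OF assms] by simp
next
  case False
  then show ?thesis
    using reg_rep_apply [OF representable_units, OF assms] by simp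
qed

end

section \<open>Compact open sets and compactly supported functions\<close>

text \<open>In a locally compact Hausdorff space a compact connected component is also a quasi-component, so a
  clopen set \<open>T\<close> separates the point \<open>x\<close> from the compact set \<open>C - U\<close>, where \<open>U\<close> is an open and \<open>C\<close> a compact
  neighbourhood of \<open>x\<close>. Then \<open>T \<inter> U\<close> equals \<open>T \<inter> C\<close> and is both open and compact.\<close>
lemma compact_open_neighbourhood:
  assumes "locally_compact_space X" "Hausdorff_space X" "totally_disconnected_space X"
    and W: "openin X W" "x \<in> W"
  obtains K where "openin X K" "compactin X K" "x \<in> K" "K \<subseteq> W"
proof -
  have x: "x \<in> topspace X" using W openin_subset by blast
  obtain U C where U: "openin X U" "x \<in> U" "U \<subseteq> C" and C: "compactin X C" "C \<subseteq> W"
    using assms locally_compact_space_neighbourhood_base [of X]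
    unfolding neighbourhood_base_of by metis
  have "{x} \<in> connected_components_of X"
    using assms(3) x unfolding connected_components_of_def totally_disconnected_space_def by force
  then have "{x} \<in> quasi_components_of X"
    using compact_quasi_eq_connected_components_of [of X "{x}"] assms x by simp
  moreover have "compactin X (C - U)"
    using closed_compactin [OF C(1), of "C - U"] compactin_imp_closedin [OF assms(2) C(1)] U(1)
    by (simp add: closedin_diff)
  ultimately have "separated_between X {x} (C - U)"
    using U(2) by (simp add: separated_between_quasi_component_compact)
  then obtain T where T: "closedin X T" "openin X T" "x \<in> T" "C - U \<subseteq> topspace X - T"
    by (auto simp: separated_between)
  then have eq: "T \<inter> U = T \<inter> C" using U(3) by blast
  show thesis
  proof
    show "openin X (T \<inter> U)" using T U by blast
    show "compactin X (T \<inter> U)"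
      unfolding eq using closed_Int_compactin [OF T(1) C(1)] .
  qed (use T U C in auto)
qed

lemma Cc_support:
  assumes "f \<in> Cc H"
  obtains C M where "compactin (gtop H) C" "\<And>g. g \<notin> C \<Longrightarrow> f g = 0" "\<And>g. cmod (f g) \<le> M"
proof -
  define C where "C = gtop H closure_of {g \<in> gcarrier H. f g \<noteq> 0}"
  have C: "compactin (gtop H) C" and f: "continuous_map (gtop H) euclidean f"
    and f0: "\<And>g. g \<notin> gcarrier H \<Longrightarrow> f g = 0"
    using assms unfolding Cc_def C_def by blast+
  have outside: "f g = 0" if "g \<notin> C" for g
    using closure_of_subset [of "{g \<in> gcarrier H. f g \<noteq> 0}" "gtop H"] f0 [of g] that
    by (auto simp: C_def gcarrier_def)
  have "bounded (f ` C)"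
    using image_compactin [OF C f] by (simp add: compact_imp_bounded)
  then obtain M where M: "\<And>g. g \<in> C \<Longrightarrow> cmod (f g) \<le> M"
    by (auto simp: bounded_iff)
  have "cmod (f g) \<le> max M 0" for g
    using M [of g] outside [of g] by (cases "g \<in> C") auto
  with C outside that show thesis by blast
qed

lemma Cc_clopen_support:
  assumes "Hausdorff_space (gtop H)" "openin (gtop H) K" "compactin (gtop H) K"
    and f: "continuous_map (subtopology (gtop H) K) euclidean f"
    and f0: "\<And>g. g \<notin> K \<Longrightarrow> f g = 0"
  shows "f \<in> Cc H"
proof -
  have K: "closedin (gtop H) K" using assms compactin_imp_closedin by blast
  have sub: "K \<subseteq> gcarrier H" using assms(2) openin_subset by (auto simp: gcarrier_def)
  have "continuous_map (gtop H) euclidean f"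
  proof (rule pasting_lemma [where I = UNIV and T = "\<lambda>b. if b then K else topspace (gtop H) - K"
        and f = "\<lambda>b. if b then f else (\<lambda>_. 0)"])
    show "openin (gtop H) (if b then K else topspace (gtop H) - K)" for b
      using K assms(2) by auto
    show "continuous_map (subtopology (gtop H) (if b then K else topspace (gtop H) - K)) euclidean
        (if b then f else (\<lambda>_. 0))" for b
      using f by auto
    show "\<exists>b. b \<in> UNIV \<and> g \<in> (if b then K else topspace (gtop H) - K)
        \<and> f g = (if b then f else (\<lambda>_. 0)) g" if "g \<in> topspace (gtop H)" for g
      using that f0 [of g] by (intro exI [of _ "g \<in> K"]) simp
  qed (auto split: if_splits)
  moreover have "gtop H closure_of {g \<in> gcarrier H. f g \<noteq> 0} \<subseteq> K"
    by (rule closure_of_minimal) (use K f0 in auto)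
  then have "compactin (gtop H) (gtop H closure_of {g \<in> gcarrier H. f g \<noteq> 0})"
    using closed_compactin [OF assms(3)] by auto
  ultimately show ?thesis
    using sub f0 by (auto simp: Cc_def)
qed

lemma indicator_in_Cc:
  assumes "Hausdorff_space (gtop H)" "openin (gtop H) K" "compactin (gtop H) K"
  shows "indicator K \<in> Cc H"
proof (rule Cc_clopen_support [OF assms])
  show "continuous_map (subtopology (gtop H) K) euclidean (indicator K :: _ \<Rightarrow> complex)"
    by (rule continuous_map_eq [of _ _ "\<lambda>_. 1"]) auto
qed auto

lemma Cc_add:
  assumes "f \<in> Cc H" "f' \<in> Cc H"
  shows "(\<lambda>g. f g + f' g) \<in> Cc H"
proof -
  let ?supp = "\<lambda>f :: _ \<Rightarrow> complex. gtop H closure_of {g \<in> gcarrier H. f g \<noteq> 0}"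
  have "compactin (gtop H) (?supp f \<union> ?supp f')"
    using assms by (auto simp: Cc_def intro: compactin_Un)
  moreover have "?supp (\<lambda>g. f g + f' g) \<subseteq> ?supp f \<union> ?supp f'"
    unfolding closure_of_Un [symmetric] by (rule closure_of_mono) auto
  ultimately have "compactin (gtop H) (?supp (\<lambda>g. f g + f' g))"
    by (rule closed_compactin) simp
  with assms show ?thesis
    by (auto simp: Cc_def intro: continuous_map_add)
qed

section \<open>Etale and ample groupoids\<close>

lemma local_homeomorphism_imp_open_map:
  assumes "local_homeomorphism X Y f"
  shows "open_map X Y f"
proof (clarsimp simp: open_map_def)
  fix V assume V: "openin X V"
  show "openin Y (f ` V)"
  proof (subst openin_subopen, clarify)
    fix x assume "x \<in> V"
    with V assms obtain U where U: "openin X U" "x \<in> U" "openin Y (f ` U)"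
      "homeomorphic_map (subtopology X U) (subtopology Y (f ` U)) f"
      unfolding local_homeomorphism_def by (meson openin_subset subsetD)
    have "openin (subtopology X U) (V \<inter> U)"
      using V by (auto simp: openin_subtopology)
    then have "openin (subtopology Y (f ` U)) (f ` (V \<inter> U))"
      using homeomorphic_imp_open_map [OF U(4)] by (auto simp: open_map_def)
    then have "openin Y (f ` (V \<inter> U))"
      using U(3) openin_trans_full by blast
    then show "\<exists>T. openin Y T \<and> f x \<in> T \<and> T \<subseteq> f ` V"
      using \<open>x \<in> V\<close> U(2) by (intro exI [of _ "f ` (V \<inter> U)"]) auto
  qed
qed

lemma local_homeomorphism_locally_inj:
  assumes "local_homeomorphism X Y f" "x \<in> topspace X"
  obtains U where "openin X U" "x \<in> U" "inj_on f U"
proof -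
  obtain U where U: "openin X U" "x \<in> U" "homeomorphic_map (subtopology X U) (subtopology Y (f ` U)) f"
    using assms unfolding local_homeomorphism_def by blast
  moreover have "topspace X \<inter> U = U" using openin_subset [OF U(1)] by blast
  ultimately have "inj_on f U"
    using homeomorphic_imp_injective_map [OF U(3)] by simp
  with U that show thesis by blast
qed

context topological_groupoid
begin

lemma topspace_unit_top [simp]: "topspace (unit_top G) = units G"
  using units_carrier by (auto simp: unit_top_def gcarrier_def)

lemma continuous_grng: "continuous_map (gtop G) (gtop G) (grng G)"
proof -
  have "continuous_map (gtop G) (subtopology (prod_topology (gtop G) (gtop G)) (gcomp G))
      (\<lambda>g. (g, ginv G g))"
    by (rule continuous_map_into_subtopology)
      (auto simp: continuous_map_pairedI continuous_inv gcarrier_def [symmetric] comp_inv)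
  from continuous_map_compose [OF this continuous_mult] show ?thesis
    by (rule continuous_map_eq) (simp add: grng_def)
qed

lemma continuous_gdom: "continuous_map (gtop G) (gtop G) (gdom G)"
  by (rule continuous_map_eq [OF continuous_map_compose [OF continuous_inv continuous_grng]])
    (simp add: gcarrier_def [symmetric])

lemma openin_inv_image:
  assumes "openin (gtop G) B" shows "openin (gtop G) (ginv G ` B)"
proof -
  have "B \<subseteq> gcarrier G" using openin_subset [OF assms] by (simp add: gcarrier_def)
  then have "ginv G ` B = {g \<in> topspace (gtop G). ginv G g \<in> B}"
    unfolding gcarrier_def [symmetric]
    by (auto simp: inv_inv subsetD inv_closed image_iff) (metis inv_inv)
  then show ?thesis
    using openin_continuous_map_preimage [OF continuous_inv assms] by simp
qed

end

context etale_groupoid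
begin

text \<open>Near a unit, \<open>r\<close> is injective; if \<open>g\<close> and \<open>r(g)\<close> are both in a set on which \<open>r\<close> is injective, then
  \<open>r(r(g)) = r(g)\<close> forces \<open>g = r(g)\<close>.\<close>
lemma openin_units: "openin (gtop G) (units G)"
proof (subst openin_subopen, clarify)
  fix x assume x: "x \<in> units G"
  obtain U where U: "openin (gtop G) U" "x \<in> U" "inj_on (grng G) U"
    using local_homeomorphism_locally_inj [OF local_homeo_rng] units_carrier [OF x]
    by (auto simp: gcarrier_def)
  show "\<exists>T. openin (gtop G) T \<and> x \<in> T \<and> T \<subseteq> units G"
  proof (intro exI conjI)
    show "openin (gtop G) {g \<in> U. grng G g \<in> U}"
      by (rule openin_continuous_map_preimage_gen [OF continuous_grng U(1) U(1)])
    show "{g \<in> U. grng G g \<in> U} \<subseteq> units G"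
    proof clarify
      fix g assume g: "g \<in> U" "grng G g \<in> U"
      have "g \<in> gcarrier G" using g U(1) openin_subset by (auto simp: gcarrier_def)
      then have "grng G g \<in> units G" by (rule grng_in_units)
      moreover from this have "grng G g = g"
        using inj_onD [OF U(3) _ g(2) g(1)] by (simp add: grng_unit)
      ultimately show "g \<in> units G" by simp
    qed
  qed (use U x in \<open>auto simp: grng_unit\<close>)
qed

lemma openin_unit_top: "openin (unit_top G) K \<longleftrightarrow> openin (gtop G) K \<and> K \<subseteq> units G"
  unfolding unit_top_def using openin_open_subtopology [OF openin_units] by blast

lemma compactin_unit_top: "compactin (unit_top G) K \<longleftrightarrow> compactin (gtop G) K \<and> K \<subseteq> units G"
  unfolding unit_top_def by (simp add: compactin_subtopology)

lemma open_grng: "openin (gtop G) V \<Longrightarrow> openin (gtop G) (grng G ` V)"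
  using local_homeomorphism_imp_open_map [OF local_homeo_rng] openin_unit_top
  by (auto simp: open_map_def)

lemma open_gdom: "openin (gtop G) V \<Longrightarrow> openin (gtop G) (gdom G ` V)"
  using local_homeomorphism_imp_open_map [OF local_homeo_dom] openin_unit_top
  by (auto simp: open_map_def)

lemma open_bisection_neighbourhood:
  assumes "g \<in> gcarrier G"
  obtains W where "openin (gtop G) W" "g \<in> W" "inj_on (grng G) W" "inj_on (gdom G) W"
proof -
  have g: "g \<in> topspace (gtop G)" using assms by (simp add: gcarrier_def)
  obtain U where "openin (gtop G) U" "g \<in> U" "inj_on (grng G) U"
    by (rule local_homeomorphism_locally_inj [OF local_homeo_rng g])
  moreover obtain V where "openin (gtop G) V" "g \<in> V" "inj_on (gdom G) V"
    by (rule local_homeomorphism_locally_inj [OF local_homeo_dom g])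
  ultimately show thesis
    using that [of "U \<inter> V"] by (auto intro: inj_on_subset)
qed

text \<open>A compact set is covered by finitely many open bisections, and each of them meets a fibre of \<open>r\<close> or
  \<open>d\<close> at most once.\<close>
lemma compact_fibre_bounded:
  assumes C: "compactin (gtop G) C"
  obtains N where "fibre_bounded G N C"
proof -
  have "C \<subseteq> \<Union>{W. openin (gtop G) W \<and> inj_on (grng G) W \<and> inj_on (gdom G) W}"
    using compactin_subset_topspace [OF C] open_bisection_neighbourhood
    unfolding gcarrier_def by blast
  then obtain \<W> where W: "finite \<W>" "C \<subseteq> \<Union>\<W>"
    "\<W> \<subseteq> {W. openin (gtop G) W \<and> inj_on (grng G) W \<and> inj_on (gdom G) W}"
    using compactinD [OF C, of "{W. openin (gtop G) W \<and> inj_on (grng G) W \<and> inj_on (gdom G) W}"]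
    by auto
  have "finite {g \<in> C. \<phi> g = x} \<and> card {g \<in> C. \<phi> g = x} \<le> card \<W>"
    if inj: "\<And>W. W \<in> \<W> \<Longrightarrow> inj_on \<phi> W" for \<phi> :: "'a \<Rightarrow> 'a" and x
  proof -
    have "\<forall>g\<in>C. \<exists>W. W \<in> \<W> \<and> g \<in> W" using W(2) by blast
    then obtain w where w: "\<And>g. g \<in> C \<Longrightarrow> w g \<in> \<W> \<and> g \<in> w g"
      by (auto dest!: bchoice)
    have "inj_on w {g \<in> C. \<phi> g = x}"
    proof (rule inj_onI)
      fix g h assume "g \<in> {g \<in> C. \<phi> g = x}" "h \<in> {g \<in> C. \<phi> g = x}" "w g = w h"
      then show "g = h" using w [of g] w [of h] inj_onD [OF inj, of "w g" g h] by simp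
    qed
    moreover have "w ` {g \<in> C. \<phi> g = x} \<subseteq> \<W>" using w by auto
    ultimately show ?thesis
      using W(1) by (meson card_inj_on_le inj_on_finite)
  qed
  with W(3) have "fibre_bounded G (card \<W>) C"
    unfolding fibre_bounded_def by blast
  then show thesis by (rule that)
qed

lemma representable_compact_support:
  assumes "compactin (gtop G) C" "\<And>g. g \<notin> C \<Longrightarrow> f g = 0" "\<And>g. cmod (f g) \<le> M"
  shows "representable G f"
  using compact_fibre_bounded [OF assms(1)] compactin_subset_topspace [OF assms(1)] assms(2,3)
  unfolding representable_def gcarrier_def by metis

lemma Cc_representable: "f \<in> Cc G \<Longrightarrow> representable G f"
  by (elim Cc_support representable_compact_support)

text \<open>On \<open>W\<close> the map \<open>r\<close> is a homeomorphism onto an open set, so compact open sets can be pulled back.\<close>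
lemma compact_open_section:
  assumes W: "openin (gtop G) W" "inj_on (grng G) W"
    and K: "openin (gtop G) K" "compactin (gtop G) K" "K \<subseteq> grng G ` W"
  defines "B \<equiv> {g \<in> W. grng G g \<in> K}"
  shows "openin (gtop G) B" "compactin (gtop G) B" "grng G ` B = K"
proof -
  have sub: "topspace (gtop G) \<inter> W = W" using openin_subset [OF W(1)] by blast
  have sub': "topspace (gtop G) \<inter> grng G ` W = grng G ` W"
    using openin_subset [OF open_grng [OF W(1)]] by blast
  show "openin (gtop G) B"
    unfolding B_def by (rule openin_continuous_map_preimage_gen [OF continuous_grng W(1) K(1)])
  show r: "grng G ` B = K" using K(3) by (auto simp: B_def)
  have "open_map (subtopology (gtop G) W) (subtopology (gtop G) (grng G ` W)) (grng G)"
    using W(1) openin_open_subtopology [OF open_grng [OF W(1)]]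
    by (auto simp: open_map_def openin_open_subtopology open_grng)
  moreover have "continuous_map (subtopology (gtop G) W) (subtopology (gtop G) (grng G ` W)) (grng G)"
    by (rule continuous_map_into_subtopology [OF continuous_map_from_subtopology [OF continuous_grng]]) auto
  ultimately have "homeomorphic_map (subtopology (gtop G) W) (subtopology (gtop G) (grng G ` W)) (grng G)"
    using W(2) by (intro bijective_open_imp_homeomorphic_map) (auto simp: sub sub')
  moreover have "compactin (subtopology (gtop G) (grng G ` W)) (grng G ` B)"
    unfolding r using K by (simp add: compactin_subtopology)
  ultimately have "compactin (subtopology (gtop G) W) B"
    by (subst (asm) homeomorphic_map_compactness) (auto simp: sub B_def)
  then show "compactin (gtop G) B" by (simp add: compactin_subtopology)
qed

end

context ample_groupoid
begin

lemma compact_open_units_neighbourhood: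
  assumes "openin (gtop G) W" "x \<in> W" "x \<in> units G"
  obtains K where "openin (gtop G) K" "compactin (gtop G) K" "x \<in> K" "K \<subseteq> W" "K \<subseteq> units G"
proof -
  have "locally_compact_space (unit_top G)"
    unfolding unit_top_def
    by (rule locally_compact_space_open_subset) (use Hausdorff locally_compact openin_units in auto)
  moreover have "Hausdorff_space (unit_top G)"
    unfolding unit_top_def by (rule Hausdorff_space_subtopology [OF Hausdorff])
  moreover have "openin (unit_top G) (W \<inter> units G)"
    unfolding openin_unit_top using assms openin_units by blast
  ultimately obtain K where "openin (unit_top G) K" "compactin (unit_top G) K" "x \<in> K" "K \<subseteq> W \<inter> units G"
    using compact_open_neighbourhood totally_disconnected_units assms by (metis IntI)
  with that show thesis by (auto simp: openin_unit_top compactin_unit_top)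
qed

end

section \<open>Closed ideals\<close>

lemma scaleC_op_apply [simp]: "blinfun_apply (scaleC_op c T) \<xi> = scaleC c (T \<xi>)"
  by (simp add: scaleC_op_def bounded_linear_Blinfun_apply [OF bounded_linear_scaleC])

lemma scaleC_op_minus_one: "scaleC_op (-1) T = - T"
  by (intro blinfun_eqI ell2_eqI) (simp add: blinfun.minus_left, transfer, simp)

lemma continuous_scaleC_op: "continuous_on S (scaleC_op c)"
  unfolding scaleC_op_def
  by (intro bounded_bilinear.continuous_on [OF bounded_bilinear_blinfun_compose] continuous_intros)

lemma closed_idealD:
  assumes "closed_ideal A I"
  shows "I \<subseteq> A" "closed I" "0 \<in> I"
    and "\<And>S T. S \<in> I \<Longrightarrow> T \<in> I \<Longrightarrow> S + T \<in> I"
    and "\<And>c T. T \<in> I \<Longrightarrow> scaleC_op c T \<in> I"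
    and "\<And>S T. S \<in> A \<Longrightarrow> T \<in> I \<Longrightarrow> S o\<^sub>L T \<in> I"
    and "\<And>S T. S \<in> A \<Longrightarrow> T \<in> I \<Longrightarrow> T o\<^sub>L S \<in> I"
  using assms by (auto simp: closed_ideal_def)

lemma closed_ideal_diff:
  assumes "closed_ideal A I" "S \<in> I" "T \<in> I" shows "S - T \<in> I"
  using closed_idealD(4) [OF assms(1,2) closed_idealD(5) [OF assms(1,3), of "-1"]]
  by (simp add: scaleC_op_minus_one)

lemma star_hom_zero:
  assumes "star_hom A B \<psi>" "0 \<in> A" shows "\<psi> 0 = 0"
proof -
  have "\<psi> (0 + 0) = \<psi> 0 + \<psi> 0" using assms unfolding star_hom_def by blast
  then show ?thesis by simp
qed

text \<open>Surjectivity of \<open>\<psi>\<close> makes \<open>\<psi>(I)\<close> absorb multiplication by all of \<open>B\<close>; the closure inherits the ideal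
  axioms by continuity of the operations in each argument.\<close>
lemma closed_ideal_closure_image:
  assumes \<psi>: "star_hom A B \<psi>" "\<psi> ` A = B" and I: "closed_ideal A I" and B: "closed B"
  shows "closed_ideal B (closure (\<psi> ` I))"
proof -
  note I' = closed_idealD [OF I]
  have hom: "\<psi> (S + T) = \<psi> S + \<psi> T" "\<psi> (S o\<^sub>L T) = \<psi> S o\<^sub>L \<psi> T" "\<psi> (scaleC_op c T) = scaleC_op c (\<psi> T)"
    if "S \<in> A" "T \<in> A" for S T c
    using \<psi>(1) that by (auto simp: star_hom_def)
  have into: "F X \<in> closure (\<psi> ` I)"
    if "continuous_on UNIV F" "X \<in> closure (\<psi> ` I)"
      "\<And>S. S \<in> I \<Longrightarrow> F (\<psi> S) \<in> closure (\<psi> ` I)" for F X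
  proof -
    have "F ` closure (\<psi> ` I) \<subseteq> closure (\<psi> ` I)"
      by (rule image_closure_subset [OF continuous_on_subset [OF that(1)]]) (use that(3) in auto)
    with that(2) show ?thesis by blast
  qed
  have mem: "\<psi> S \<in> closure (\<psi> ` I)" if "S \<in> I" for S
    by (rule subsetD [OF closure_subset]) (use that in simp)
  have add1: "X + \<psi> T \<in> closure (\<psi> ` I)" if "X \<in> closure (\<psi> ` I)" "T \<in> I" for X T
  proof (rule into [where F = "\<lambda>X. X + \<psi> T", OF _ that(1)])
    fix S assume "S \<in> I"
    with that I'(1) have "\<psi> S + \<psi> T = \<psi> (S + T)" by (simp add: hom(1) subsetD)
    with I'(4) [OF \<open>S \<in> I\<close> that(2)] mem show "\<psi> S + \<psi> T \<in> closure (\<psi> ` I)" by simp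
  qed (intro continuous_intros)
  have add2: "X + Y \<in> closure (\<psi> ` I)" if "X \<in> closure (\<psi> ` I)" "Y \<in> closure (\<psi> ` I)" for X Y
    by (rule into [where F = "\<lambda>Y. X + Y", OF _ that(2) add1 [OF that(1)]]) (intro continuous_intros)
  have scale: "scaleC_op c X \<in> closure (\<psi> ` I)" if "X \<in> closure (\<psi> ` I)" for c X
  proof (rule into [OF continuous_scaleC_op that])
    fix S assume "S \<in> I"
    with I'(1) have "scaleC_op c (\<psi> S) = \<psi> (scaleC_op c S)" using hom(3) [of S S c] by (simp add: subsetD)
    with I'(5) [OF \<open>S \<in> I\<close>] mem show "scaleC_op c (\<psi> S) \<in> closure (\<psi> ` I)" by simp
  qed
  have comp: "\<psi> S o\<^sub>L X \<in> closure (\<psi> ` I)" "X o\<^sub>L \<psi> S \<in> closure (\<psi> ` I)"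
    if S: "S \<in> A" and X: "X \<in> closure (\<psi> ` I)" for S X
  proof -
    have "\<psi> S o\<^sub>L \<psi> T \<in> closure (\<psi> ` I)" "\<psi> T o\<^sub>L \<psi> S \<in> closure (\<psi> ` I)" if "T \<in> I" for T
      using mem [OF I'(6) [OF S that]] mem [OF I'(7) [OF S that]] hom(2) [of S T] hom(2) [of T S]
        S that I'(1) by auto
    moreover have "continuous_on UNIV (\<lambda>X. \<psi> S o\<^sub>L X)" "continuous_on UNIV (\<lambda>X. X o\<^sub>L \<psi> S)"
      by (intro bounded_bilinear.continuous_on [OF bounded_bilinear_blinfun_compose] continuous_intros)+
    ultimately show "\<psi> S o\<^sub>L X \<in> closure (\<psi> ` I)" "X o\<^sub>L \<psi> S \<in> closure (\<psi> ` I)"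
      using into [OF _ X] by auto
  qed
  have "closure (\<psi> ` I) \<subseteq> B"
    by (rule closure_minimal) (use \<psi>(2) I'(1) B in auto)
  moreover have "0 \<in> closure (\<psi> ` I)"
    using mem [OF I'(3)] star_hom_zero [OF \<psi>(1)] I' by auto
  ultimately show ?thesis
    unfolding closed_ideal_def using add2 scale comp \<psi>(2) by auto
qed

section \<open>Diagonal operators and bisections\<close>

context algebraic_groupoid
begin

lemma reg_rep_indicator_units_apply:
  assumes "K \<subseteq> units G"
  shows "ell2_apply (reg_rep G (indicator K) \<xi>) g
    = (if g \<in> gcarrier G \<and> grng G g \<in> K then ell2_apply \<xi> g else 0)"
proof -
  have "ell2_apply (reg_rep G (indicator K) \<xi>) g
      = (if g \<in> gcarrier G then indicator K (grng G g) * ell2_apply \<xi> g else 0)"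
    by (rule reg_rep_units_apply [where M = 1]) (use assms in \<open>auto split: split_indicator\<close>)
  then show ?thesis by simp
qed

lemma reg_rep_units_compose:
  assumes f: "\<And>g. g \<notin> units G \<Longrightarrow> f g = 0" "\<And>g. cmod (f g) \<le> M"
    and f': "\<And>g. g \<notin> units G \<Longrightarrow> f' g = 0" "\<And>g. cmod (f' g) \<le> M'"
  shows "reg_rep G f o\<^sub>L reg_rep G f' = reg_rep G (\<lambda>g. f g * f' g)"
proof (rule operator_eqI)
  fix \<xi> g
  have "ell2_apply (reg_rep G (\<lambda>g. f g * f' g) \<xi>) g
      = (if g \<in> gcarrier G then f (grng G g) * f' (grng G g) * ell2_apply \<xi> g else 0)"
  proof (rule reg_rep_units_apply)
    show "cmod (f g * f' g) \<le> M * M'" for g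
      unfolding norm_mult by (rule mult_mono) (use f f' order_trans [OF norm_ge_zero f(2)] in auto)
  qed (use f in auto)
  then show "ell2_apply ((reg_rep G f o\<^sub>L reg_rep G f') \<xi>) g
      = ell2_apply (reg_rep G (\<lambda>g. f g * f' g) \<xi>) g"
    by (simp add: reg_rep_units_apply [OF f] reg_rep_units_apply [OF f'])
qed

lemma reg_rep_indicator_idem:
  "K \<subseteq> units G \<Longrightarrow> reg_rep G (indicator K) o\<^sub>L reg_rep G (indicator K) = reg_rep G (indicator K)"
  by (rule operator_eqI) (simp add: reg_rep_indicator_units_apply)

lemma is_projection_indicator:
  assumes "K \<subseteq> units G" shows "is_projection (reg_rep G (indicator K))"
  unfolding is_projection_def is_adjoint_def cinner_def
  by (auto simp: reg_rep_indicator_idem [OF assms] reg_rep_indicator_units_apply [OF assms]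
      intro!: infsum_cong)

lemma reg_rep_indicator_empty: "reg_rep G (indicator {}) = 0"
  by (rule operator_eqI) (subst reg_rep_indicator_units_apply, auto)

lemma reg_rep_indicator_Un:
  assumes "K \<subseteq> units G" "L \<subseteq> units G"
  shows "reg_rep G (indicator (K \<union> L)) = reg_rep G (indicator K) + reg_rep G (indicator L)
    - (reg_rep G (indicator K) o\<^sub>L reg_rep G (indicator L))"
proof -
  have "K \<union> L \<subseteq> units G" using assms by blast
  then show ?thesis
    by (intro operator_eqI)
      (auto simp: reg_rep_indicator_units_apply assms blinfun.add_left blinfun.diff_left)
qed

text \<open>The kernel \<open>f (g h\<^sup>-\<^sup>1)\<close> is nonzero only if \<open>r(h) = d(g h\<^sup>-\<^sup>1)\<close> lies in \<open>K\<close>, so multiplying \<open>\<xi>\<close> by the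
  indicator function of \<open>K\<close> at \<open>r(h)\<close> changes nothing.\<close>
lemma reg_rep_compose_indicator:
  assumes f: "representable G f" and K: "K \<subseteq> units G"
    and dom: "\<And>g. g \<in> gcarrier G \<Longrightarrow> f g \<noteq> 0 \<Longrightarrow> gdom G g \<in> K"
  shows "reg_rep G f o\<^sub>L reg_rep G (indicator K) = reg_rep G f"
proof (rule operator_eqI)
  fix \<xi> g
  show "ell2_apply ((reg_rep G f o\<^sub>L reg_rep G (indicator K)) \<xi>) g = ell2_apply (reg_rep G f \<xi>) g"
  proof (cases "g \<in> gcarrier G")
    case True
    have "(\<Sum>\<^sub>\<infinity>h\<in>{h \<in> gcarrier G. gdom G h = gdom G g}.
          f (gmult G g (ginv G h)) * ell2_apply (reg_rep G (indicator K) \<xi>) h)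
        = (\<Sum>\<^sub>\<infinity>h\<in>{h \<in> gcarrier G. gdom G h = gdom G g}. f (gmult G g (ginv G h)) * ell2_apply \<xi> h)"
    proof (rule infsum_cong)
      fix h assume "h \<in> {h \<in> gcarrier G. gdom G h = gdom G g}"
      then show "f (gmult G g (ginv G h)) * ell2_apply (reg_rep G (indicator K) \<xi>) h
          = f (gmult G g (ginv G h)) * ell2_apply \<xi> h"
        using dom [of "gmult G g (ginv G h)"] True quotient_carrier [of g h] gdom_quotient [of g h]
        by (auto simp: reg_rep_indicator_units_apply [OF K])
    qed
    with True show ?thesis by (simp add: reg_rep_apply [OF f])
  qed (simp add: reg_rep_apply_outside [OF f])
qed

text \<open>If \<open>r\<close> is injective on \<open>B\<close>, the only \<open>h\<close> with \<open>k h\<^sup>-\<^sup>1\<close> in \<open>B\<close> is \<open>b\<^sup>-\<^sup>1 k\<close>; so the indicator function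
  of \<open>B\<close> acts as a partial translation.\<close>
lemma reg_rep_section_apply:
  assumes B: "B \<subseteq> gcarrier G" "inj_on (grng G) B" "representable G (indicator B)"
    and b: "b \<in> B" and k: "k \<in> gcarrier G" "grng G k = grng G b"
  shows "ell2_apply (reg_rep G (indicator B) \<xi>) k = ell2_apply \<xi> (gmult G (ginv G b) k)"
proof -
  let ?h = "gmult G (ginv G b) k"
  have bc: "b \<in> gcarrier G" using B(1) b by blast
  have comp: "(ginv G b, k) \<in> gcomp G"
    using bc k by (simp add: comp_iff inv_closed)
  have h: "?h \<in> gcarrier G" "gdom G ?h = gdom G k"
    using mult_closed [OF comp] gdom_mult [OF comp] by auto
  have quot: "gmult G k (ginv G ?h) = b"
  proof -
    have "grng G ?h = gdom G b" using grng_mult [OF comp] bc by simp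
    then have "(b, ?h) \<in> gcomp G" using bc h by (simp add: comp_iff)
    moreover have "gmult G b ?h = k"
      using inv_cancel_left [OF comp] bc by (simp add: inv_inv)
    ultimately show ?thesis using inv_cancel_right by fastforce
  qed
  have uniq: "h = ?h"
    if "h \<in> gcarrier G" "gdom G h = gdom G k" "gmult G k (ginv G h) \<in> B" for h
  proof -
    have "gmult G k (ginv G h) = b"
      using inj_onD [OF B(2) _ that(3) b] grng_quotient [of k h] k that by simp
    then show ?thesis using quotient_inv_mult [of k h] k that by simp
  qed
  have "(\<Sum>\<^sub>\<infinity>h\<in>{h \<in> gcarrier G. gdom G h = gdom G k}. indicator B (gmult G k (ginv G h)) * ell2_apply \<xi> h)
      = (\<Sum>\<^sub>\<infinity>h\<in>{?h}. ell2_apply \<xi> h)"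
  proof (rule infsum_cong_neutral)
    fix h assume "h \<in> {h \<in> gcarrier G. gdom G h = gdom G k} - {?h}"
    with uniq have "gmult G k (ginv G h) \<notin> B" by blast
    then show "indicator B (gmult G k (ginv G h)) * ell2_apply \<xi> h = 0" by simp
  next
    fix h assume "h \<in> {h \<in> gcarrier G. gdom G h = gdom G k} \<inter> {?h}"
    then show "indicator B (gmult G k (ginv G h)) * ell2_apply \<xi> h = ell2_apply \<xi> h"
      using quot b by simp
  qed (use h in simp)
  then show ?thesis using reg_rep_apply [OF B(3)] k by simp
qed

lemma reg_rep_section_apply_eq_0:
  assumes "representable G (indicator B)" "grng G k \<notin> grng G ` B"
  shows "ell2_apply (reg_rep G (indicator B) \<xi>) k = 0"
proof (cases "k \<in> gcarrier G")
  case True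
  have "(\<Sum>\<^sub>\<infinity>h\<in>{h \<in> gcarrier G. gdom G h = gdom G k}.
      indicator B (gmult G k (ginv G h)) * ell2_apply \<xi> h) = 0"
  proof (rule infsum_0)
    fix h assume "h \<in> {h \<in> gcarrier G. gdom G h = gdom G k}"
    then have "grng G (gmult G k (ginv G h)) = grng G k"
      using True by (simp add: grng_quotient)
    with assms(2) have "gmult G k (ginv G h) \<notin> B" by (metis imageI)
    then show "indicator B (gmult G k (ginv G h)) * ell2_apply \<xi> h = 0" by simp
  qed
  with True show ?thesis using reg_rep_apply [OF assms(1)] by simp
qed (simp add: reg_rep_apply_outside assms)

text \<open>The operator of \<open>B\<inverse>\<close> reads a function at \<open>b k\<close>, where \<open>b\<close> is the element of \<open>B\<close> with \<open>d(b) = r(k)\<close>.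
  At that place the projection of \<open>K\<close> acts as the identity, because \<open>r(b k) = r(b)\<close> is in \<open>K\<close>, and the
  operator of \<open>B\<close> leads back to \<open>b\<^sup>-\<^sup>1 b k = k\<close>.\<close>
lemma bisection_conjugate:
  assumes B: "B \<subseteq> gcarrier G" "inj_on (grng G) B" "inj_on (gdom G) B"
    and rep: "representable G (indicator B)" "representable G (indicator (ginv G ` B))"
    and K: "grng G ` B \<subseteq> K" "K \<subseteq> units G"
  shows "reg_rep G (indicator (ginv G ` B)) o\<^sub>L (reg_rep G (indicator K) o\<^sub>L reg_rep G (indicator B))
    = reg_rep G (indicator (gdom G ` B))"
proof (rule operator_eqI)
  fix \<xi> k
  let ?T = "reg_rep G (indicator K) o\<^sub>L reg_rep G (indicator B)"
  have B': "ginv G ` B \<subseteq> gcarrier G" using B(1) inv_closed by blast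
  have r': "grng G ` ginv G ` B = gdom G ` B"
    unfolding image_image by (rule image_cong) (use B(1) in auto)
  have inj': "inj_on (grng G) (ginv G ` B)"
    using B(1,3) by (auto simp: inj_on_def subset_iff)
  have dB: "gdom G ` B \<subseteq> units G" using B(1) gdom_in_units by blast
  show "ell2_apply ((reg_rep G (indicator (ginv G ` B)) o\<^sub>L ?T) \<xi>) k
      = ell2_apply (reg_rep G (indicator (gdom G ` B)) \<xi>) k"
  proof (cases "k \<in> gcarrier G \<and> grng G k \<in> gdom G ` B")
    case False
    then have "ell2_apply ((reg_rep G (indicator (ginv G ` B)) o\<^sub>L ?T) \<xi>) k = 0"
      using reg_rep_section_apply_eq_0 [OF rep(2)] reg_rep_apply_outside [OF rep(2)] r' by auto
    with False show ?thesis by (auto simp: reg_rep_indicator_units_apply [OF dB])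
  next
    case True
    then obtain b where b: "b \<in> B" "grng G k = gdom G b" and k: "k \<in> gcarrier G" by blast
    have bc: "b \<in> gcarrier G" using b B(1) by blast
    have comp: "(b, k) \<in> gcomp G" using b bc k by (simp add: comp_iff)
    have "ell2_apply ((reg_rep G (indicator (ginv G ` B)) o\<^sub>L ?T) \<xi>) k
        = ell2_apply (?T \<xi>) (gmult G (ginv G (ginv G b)) k)"
      unfolding blinfun_apply_blinfun_compose
      by (rule reg_rep_section_apply [OF B' inj' rep(2)]) (use b bc k in auto)
    also have "\<dots> = ell2_apply (?T \<xi>) (gmult G b k)"
      using bc by (simp add: inv_inv)
    also have "\<dots> = ell2_apply (reg_rep G (indicator B) \<xi>) (gmult G b k)"
      using mult_closed [OF comp] grng_mult [OF comp] K b(1)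
      by (auto simp: reg_rep_indicator_units_apply [OF K(2)])
    also have "\<dots> = ell2_apply \<xi> (gmult G (ginv G b) (gmult G b k))"
      by (rule reg_rep_section_apply [OF B(1,2) rep(1) b(1)])
        (use mult_closed [OF comp] grng_mult [OF comp] in auto)
    also have "\<dots> = ell2_apply \<xi> k" by (simp add: inv_cancel_left [OF comp])
    finally show ?thesis using True by (simp add: reg_rep_indicator_units_apply [OF dB])
  qed
qed

end

section \<open>The support of an ideal\<close>

text \<open>For ample \<open>G\<close> this is the open set \<open>U\<close> of units with \<open>I \<inter> C\<^sub>0(G\<^sup>(\<^sup>0\<^sup>)) = C\<^sub>0(U)\<close>. Indicator functions
  suffice to describe it because the unit space has a basis of compact open sets, and the indicator
  functions in \<open>I\<close> will turn out to generate \<open>I\<close> if \<open>G\<close> is inner exact and has the residual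
  intersection property.\<close>
definition ideal_support :: "'g groupoid \<Rightarrow> 'g operator set \<Rightarrow> 'g set"
  where "ideal_support G I = \<Union>{K. openin (gtop G) K \<and> compactin (gtop G) K \<and> K \<subseteq> units G \<and>
    reg_rep G (indicator K) \<in> I}"

lemma reg_rep_Cc_in_Cstar_red: "f \<in> Cc G \<Longrightarrow> reg_rep G f \<in> Cstar_red G"
  unfolding Cstar_red_def by (rule subsetD [OF closure_subset]) simp

context etale_groupoid
begin

lemma Cstar_red_add:
  assumes "S \<in> Cstar_red G" "T \<in> Cstar_red G" shows "S + T \<in> Cstar_red G"
proof -
  obtain s where s: "\<And>n. s n \<in> reg_rep G ` Cc G" "s \<longlonglongrightarrow> S"
    using assms(1) unfolding Cstar_red_def closure_sequential by auto
  obtain t where t: "\<And>n. t n \<in> reg_rep G ` Cc G" "t \<longlonglongrightarrow> T"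
    using assms(2) unfolding Cstar_red_def closure_sequential by auto
  have "s n + t n \<in> reg_rep G ` Cc G" for n
  proof -
    obtain f f' where "f \<in> Cc G" "f' \<in> Cc G" "s n = reg_rep G f" "t n = reg_rep G f'"
      using s(1) [of n] t(1) [of n] by blast
    then show ?thesis
      using Cc_add [of f G f'] reg_rep_add [of f f'] Cc_representable
      by (intro image_eqI [of _ _ "\<lambda>g. f g + f' g"]) auto
  qed
  moreover have "(\<lambda>n. s n + t n) \<longlonglongrightarrow> S + T" by (intro tendsto_add s t)
  ultimately show ?thesis unfolding Cstar_red_def closure_sequential
    by (intro exI [of _ "\<lambda>n. s n + t n"]) simp
qed

lemma indicator_in_Cstar_red:
  "openin (gtop G) K \<Longrightarrow> compactin (gtop G) K \<Longrightarrow> reg_rep G (indicator K) \<in> Cstar_red G"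
  by (rule reg_rep_Cc_in_Cstar_red [OF indicator_in_Cc [OF Hausdorff]])

lemma ideal_support_units: "ideal_support G I \<subseteq> units G"
  by (auto simp: ideal_support_def)

lemma openin_ideal_support: "openin (gtop G) (ideal_support G I)"
  by (auto simp: ideal_support_def)

text \<open>Finitely many of the sets that make up the support cover \<open>C\<close>, and the projection of a union is
  \<open>p + q - p q\<close>.\<close>
lemma ideal_support_compact_subset:
  assumes I: "closed_ideal (Cstar_red G) I" and J: "closed_ideal (Cstar_red G) J"
    and proj: "{P \<in> I. is_projection P} \<subseteq> J"
    and C: "compactin (gtop G) C" "C \<subseteq> ideal_support G I"
  obtains K where "C \<subseteq> K" "K \<subseteq> units G" "reg_rep G (indicator K) \<in> J"
proof -
  obtain \<F> where \<F>: "finite \<F>" "C \<subseteq> \<Union>\<F>"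
    "\<F> \<subseteq> {K. openin (gtop G) K \<and> compactin (gtop G) K \<and> K \<subseteq> units G \<and> reg_rep G (indicator K) \<in> I}"
    using compactinD [OF C(1), of "{K. openin (gtop G) K \<and> compactin (gtop G) K \<and> K \<subseteq> units G \<and>
        reg_rep G (indicator K) \<in> I}"] C(2)
    unfolding ideal_support_def by auto
  from \<F>(1,3) have "\<Union>\<F> \<subseteq> units G \<and> reg_rep G (indicator (\<Union>\<F>)) \<in> J"
  proof (induction \<F> rule: finite_induct)
    case empty
    show ?case unfolding Union_empty reg_rep_indicator_empty using closed_idealD(3) [OF J] by simp
  next
    case (insert K \<F>)
    then have K: "K \<subseteq> units G" "reg_rep G (indicator K) \<in> I" by auto
    with proj is_projection_indicator have KJ: "reg_rep G (indicator K) \<in> J" by blast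
    then have KA: "reg_rep G (indicator K) \<in> Cstar_red G" using closed_idealD(1) [OF J] by blast
    have IH: "\<Union>\<F> \<subseteq> units G" "reg_rep G (indicator (\<Union>\<F>)) \<in> J" using insert by auto
    have "reg_rep G (indicator (K \<union> \<Union>\<F>)) \<in> J"
      unfolding reg_rep_indicator_Un [OF K(1) IH(1)]
      by (intro closed_ideal_diff [OF J] closed_idealD(4) [OF J] closed_idealD(6) [OF J] KJ KA IH(2))
    with K(1) IH(1) show ?case unfolding Union_insert by (intro conjI Un_least)
  qed
  with that [OF \<F>(2)] show thesis by simp
qed

text \<open>Each \<open>f\<close> in \<open>C\<^sub>c(G\<^sub>U)\<close> is fixed by right multiplication with a projection in \<open>J\<close>; continuity of \<open>\<phi>\<close>
  extends this to the whole algebra, as \<open>J\<close> is closed.\<close>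
lemma extension_image_subset:
  assumes I: "closed_ideal (Cstar_red G) I" and J: "closed_ideal (Cstar_red G) J"
    and proj: "{P \<in> I. is_projection P} \<subseteq> J"
    and \<phi>: "extension_hom G (ideal_support G I) \<phi>"
  shows "\<phi> ` Cstar_red (reduction G (ideal_support G I)) \<subseteq> J"
proof -
  let ?H = "reduction G (ideal_support G I)"
  have "\<phi> ` reg_rep ?H ` Cc ?H \<subseteq> J"
  proof clarify
    fix f assume f: "f \<in> Cc ?H"
    then obtain C M where C: "compactin (gtop ?H) C" "\<And>g. g \<notin> C \<Longrightarrow> f g = 0" "\<And>g. cmod (f g) \<le> M"
      by (rule Cc_support) blast
    then have CG: "compactin (gtop G) C" and CU: "\<And>g. g \<in> C \<Longrightarrow> gdom G g \<in> ideal_support G I"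
      by (auto simp: compactin_subtopology)
    obtain K where K: "gdom G ` C \<subseteq> K" "K \<subseteq> units G" "reg_rep G (indicator K) \<in> J"
      using ideal_support_compact_subset [OF I J proj image_compactin [OF CG continuous_gdom]] CU
      by blast
    have dom: "gdom G g \<in> K" if "f g \<noteq> 0" for g
      using K(1) C(2) [of g] that by blast
    have rep: "representable G f"
      by (rule representable_compact_support [OF CG]) (rule C, assumption?)+
    have "reg_rep G f o\<^sub>L reg_rep G (indicator K) = reg_rep G f"
      by (rule reg_rep_compose_indicator [OF rep K(2) dom])
    moreover have eq: "\<phi> (reg_rep ?H f) = reg_rep G f"
      using \<phi> f by (auto simp: extension_hom_def)
    moreover have "\<phi> (reg_rep ?H f) \<in> Cstar_red G"
      using \<phi> reg_rep_Cc_in_Cstar_red [OF f] by (auto simp: extension_hom_def star_hom_def)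
    ultimately show "\<phi> (reg_rep ?H f) \<in> J"
      using closed_idealD(6) [OF J _ K(3), of "reg_rep G f"] by simp
  qed
  with \<phi> closed_idealD(2) [OF J] show ?thesis
    unfolding Cstar_red_def [of ?H] extension_hom_def by (intro image_closure_subset) auto
qed

end

text \<open>If \<open>r(g)\<close> were in a compact open \<open>K\<close> with projection in \<open>I\<close>, a compact open bisection \<open>B\<close> around \<open>g\<close>
  with \<open>r(B) \<subseteq> K\<close> would conjugate this projection to that of \<open>d(B)\<close>, which contains \<open>d(g)\<close>.\<close>
lemma (in ample_groupoid) invariant_ideal_support_compl:
  assumes I: "closed_ideal (Cstar_red G) I"
  shows "invariant G (units G - ideal_support G I)"
  unfolding invariant_def
proof (intro conjI ballI impI)
  fix g assume g: "g \<in> gcarrier G" "gdom G g \<in> units G - ideal_support G I"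
  show "grng G g \<in> units G - ideal_support G I"
  proof (rule ccontr)
    assume "\<not> ?thesis"
    then obtain K where K: "openin (gtop G) K" "compactin (gtop G) K" "K \<subseteq> units G"
      "reg_rep G (indicator K) \<in> I" "grng G g \<in> K"
      using grng_in_units [OF g(1)] by (auto simp: ideal_support_def)
    obtain W where W: "openin (gtop G) W" "g \<in> W" "inj_on (grng G) W" "inj_on (gdom G) W"
      by (rule open_bisection_neighbourhood [OF g(1)])
    have "openin (gtop G) (K \<inter> grng G ` W)" using K(1) open_grng [OF W(1)] by blast
    then obtain L where L: "openin (gtop G) L" "compactin (gtop G) L" "grng G g \<in> L" "L \<subseteq> K \<inter> grng G ` W"
      by (rule compact_open_units_neighbourhood) (use K W grng_in_units [OF g(1)] in auto)
    define B where "B = {g \<in> W. grng G g \<in> L}"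
    have B: "openin (gtop G) B" "compactin (gtop G) B" "grng G ` B = L" and "g \<in> B"
      unfolding B_def using compact_open_section [OF W(1,3) L(1,2)] L W(2) by auto
    have inj: "inj_on (grng G) B" "inj_on (gdom G) B"
      using W by (auto simp: B_def intro: inj_on_subset)
    have car: "B \<subseteq> gcarrier G" using openin_subset [OF B(1)] by (simp add: gcarrier_def)
    have inv: "openin (gtop G) (ginv G ` B)" "compactin (gtop G) (ginv G ` B)"
      using openin_inv_image [OF B(1)] image_compactin [OF B(2) continuous_inv] by auto
    have rep: "representable G (indicator B)" "representable G (indicator (ginv G ` B))"
      using B inv by (auto intro!: Cc_representable indicator_in_Cc Hausdorff)
    have "reg_rep G (indicator (ginv G ` B)) o\<^sub>L (reg_rep G (indicator K) o\<^sub>L reg_rep G (indicator B)) \<in> I"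
      using B inv K(4) by (intro closed_idealD(6,7) [OF I] indicator_in_Cstar_red)
    then have "reg_rep G (indicator (gdom G ` B)) \<in> I"
      using bisection_conjugate [OF car inj rep _ K(3)] B(3) L(4) by simp
    then have "gdom G ` B \<subseteq> ideal_support G I"
      unfolding ideal_support_def
      using open_gdom [OF B(1)] image_compactin [OF B(2) continuous_gdom] car gdom_in_units by blast
    with \<open>g \<in> B\<close> g(2) show False by blast
  qed
qed auto

section \<open>Restriction to the complement of the support\<close>

lemma C0_units_bounded:
  assumes "f \<in> C0_units H"
  obtains M where "\<And>g. cmod (f g) \<le> M"
proof -
  let ?C = "{x \<in> units H. 1 \<le> cmod (f x)}"
  have "compactin (unit_top H) ?C" "continuous_map (unit_top H) euclidean f"
    using assms zero_less_one unfolding C0_units_def by blast+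
  then have "bounded (f ` ?C)"
    using image_compactin by (fastforce intro: compact_imp_bounded)
  then obtain M where M: "\<And>g. g \<in> ?C \<Longrightarrow> cmod (f g) \<le> M"
    by (auto simp: bounded_iff)
  have "cmod (f g) \<le> max M 1" for g
  proof (cases "g \<in> units H")
    case True
    with M [of g] show ?thesis by force
  next
    case False
    with assms show ?thesis by (simp add: C0_units_def)
  qed
  with that show thesis by blast
qed

lemma zero_in_diagonal:
  assumes "algebraic_groupoid H" shows "0 \<in> diagonal H"
proof -
  interpret algebraic_groupoid H by (fact assms)
  have "(\<lambda>_. 0) \<in> C0_units H"
    by (auto simp: C0_units_def not_le)
  moreover have "reg_rep H (\<lambda>_. 0) = 0"
    by (rule operator_eqI, subst reg_rep_units_apply [where M = 0]) auto
  ultimately show ?thesis unfolding diagonal_def by (metis imageI)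
qed

text \<open>This replaces the general fact that a *-homomorphism maps closed ideals of a C*-algebra onto closed
  sets. If \<open>\<psi>(a)\<close> is close enough to \<open>p\<close>, then \<open>p = p \<psi>(a) y\<close> for some \<open>y\<close> in the closure; both \<open>p\<close> and
  \<open>y\<close> lift to \<open>A\<close>, and the product of the lifts with \<open>a\<close> in the middle is in \<open>I\<close>.\<close>
lemma idempotent_in_closure_image:
  assumes \<psi>: "star_hom A B \<psi>" "\<psi> ` A = B" and I: "closed_ideal A I" and B: "closed B"
    and p: "p \<in> closure (\<psi> ` I)" "p o\<^sub>L p = p"
  shows "p \<in> \<psi> ` I"
proof -
  let ?L = "closure (\<psi> ` I)"
  note I' = closed_idealD [OF I]
  have L: "closed_ideal B ?L" by (rule closed_ideal_closure_image [OF \<psi> I B])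
  note L' = closed_idealD [OF L]
  have hom: "\<psi> (S o\<^sub>L T) = \<psi> S o\<^sub>L \<psi> T" if "S \<in> A" "T \<in> A" for S T
    using \<psi>(1) that by (auto simp: star_hom_def)
  have "0 < 1 / (norm p + 1)" by (simp add: add_nonneg_pos)
  then obtain a where a: "a \<in> I" "dist (\<psi> a) p < 1 / (norm p + 1)"
    using p(1) unfolding closure_approachable by blast
  have "norm p * norm (p - \<psi> a) < 1"
  proof -
    have "norm p * norm (p - \<psi> a) \<le> (norm p + 1) * norm (p - \<psi> a)"
      by (simp add: mult_right_mono)
    also have "\<dots> < 1"
      using a(2) add_nonneg_pos [of "norm p" 1]
      by (simp add: dist_norm norm_minus_commute pos_less_divide_eq mult.commute)
    finally show ?thesis .
  qed
  moreover have "p + (p o\<^sub>L (p - \<psi> a) o\<^sub>L y) \<in> ?L" if "y \<in> ?L" for y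
  proof -
    have "p - \<psi> a \<in> ?L"
      by (rule closed_ideal_diff [OF L p(1) subsetD [OF closure_subset]]) (use a(1) in simp)
    then have "p o\<^sub>L (p - \<psi> a) \<in> ?L" using L'(1,6) p(1) by blast
    then have "p o\<^sub>L (p - \<psi> a) o\<^sub>L y \<in> ?L" using L'(1,6) that by blast
    then show ?thesis by (rule L'(4) [OF p(1)])
  qed
  ultimately obtain y where y: "y \<in> ?L" "p = p o\<^sub>L \<psi> a o\<^sub>L y"
    using idempotent_near_left_ideal [OF _ p] by (metis closed_closure)
  then obtain s t where s: "s \<in> A" "y = \<psi> s" and t: "t \<in> A" "p = \<psi> t"
    using L'(1) \<psi>(2) p(1) by blast
  have ta: "t o\<^sub>L a \<in> I" by (rule I'(6) [OF t(1) a(1)])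
  then have tas: "t o\<^sub>L a o\<^sub>L s \<in> I" by (rule I'(7) [OF s(1)])
  have "p = \<psi> (t o\<^sub>L a o\<^sub>L s)"
  proof -
    have "a \<in> A" "t o\<^sub>L a \<in> A" using a(1) ta I'(1) by auto
    then have "\<psi> (t o\<^sub>L a o\<^sub>L s) = \<psi> t o\<^sub>L \<psi> a o\<^sub>L \<psi> s" by (simp only: hom s(1) t(1))
    with y(2) show ?thesis by (simp only: s(2) t(2) [symmetric])
  qed
  with tas show ?thesis by blast
qed

context ample_groupoid
begin

text \<open>An element of \<open>C\<^sub>0(D)\<close> in the closure of \<open>\<psi>(I)\<close> yields a compact open \<open>K\<close> that meets \<open>D\<close> but whose
  projection is in \<open>I\<close>, which contradicts the definition of \<open>D\<close>.\<close>
lemma restriction_kills_ideal: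
  assumes I: "closed_ideal (Cstar_red G) I"
  defines "D \<equiv> units G - ideal_support G I"
  assumes ip: "intersection_property (reduction G D)"
    and \<psi>: "restriction_hom G D \<psi>" "\<psi> ` Cstar_red G = Cstar_red (reduction G D)"
    and ker: "{T \<in> Cstar_red G. \<psi> T = 0} \<subseteq> I"
  shows "\<psi> ` I \<subseteq> {0}"
proof (rule ccontr)
  assume nz: "\<not> \<psi> ` I \<subseteq> {0}"
  let ?H = "reduction G D" and ?L = "closure (\<psi> ` I)"
  note I' = closed_idealD [OF I]
  have D: "invariant G D" unfolding D_def by (rule invariant_ideal_support_compl [OF I])
  interpret H: algebraic_groupoid ?H by (rule algebraic_groupoid_reduction [OF D])
  have units_H: "units ?H = D" by (rule units_reduction [OF D])
  have hom: "star_hom (Cstar_red G) (Cstar_red ?H) \<psi>" using \<psi>(1) by (simp add: restriction_hom_def)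
  have closed: "closed (Cstar_red ?H)" by (simp add: Cstar_red_def)
  have L: "closed_ideal (Cstar_red ?H) ?L" by (rule closed_ideal_closure_image [OF hom \<psi>(2) I closed])
  have "?L \<noteq> {0}"
    using nz subset_trans [OF closure_subset, of "\<psi> ` I" "{0}"] by auto
  with ip L have "?L \<inter> diagonal ?H \<noteq> {0}" unfolding intersection_property_def by blast
  moreover have "0 \<in> ?L \<inter> diagonal ?H"
    using closed_idealD(3) [OF L] zero_in_diagonal [OF H.algebraic_groupoid_axioms] by blast
  ultimately obtain f where f: "f \<in> C0_units ?H" "reg_rep ?H f \<in> ?L" "reg_rep ?H f \<noteq> 0"
    unfolding diagonal_def by blast
  obtain M where M: "\<And>g. cmod (f g) \<le> M" using C0_units_bounded [OF f(1)] by blast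
  have f0: "f g = 0" if "g \<notin> D" for g
    using f(1) that by (simp add: C0_units_def units_H)
  have f_cont: "continuous_map (unit_top ?H) euclidean f"
    using f(1) by (simp add: C0_units_def)
  obtain x where x: "f x \<noteq> 0"
  proof (cases "\<exists>x. f x \<noteq> 0")
    case False
    then have "reg_rep ?H f = 0"
      using H.reg_rep_units_apply [of f M] M by (intro operator_eqI) auto
    with f(3) show ?thesis by contradiction
  qed (use that in blast)
  have unit_top_H: "unit_top ?H = subtopology (gtop G) D"
  proof -
    have "{g \<in> gcarrier G. gdom G g \<in> D} \<inter> D = D"
      using gdom_unit units_carrier by (auto simp: D_def)
    then show ?thesis unfolding unit_top_def units_H by (simp add: subtopology_subtopology)
  qed
  have "openin (subtopology (gtop G) D) {y \<in> topspace (subtopology (gtop G) D). f y \<in> - {0}}"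
    by (rule openin_continuous_map_preimage [OF f_cont [unfolded unit_top_H]]) auto
  then obtain W where W: "openin (gtop G) W"
    "{y \<in> topspace (subtopology (gtop G) D). f y \<in> - {0}} = W \<inter> D"
    by (auto simp: openin_subtopology)
  have D_car: "D \<subseteq> topspace (gtop G)"
    using units_carrier by (auto simp: D_def gcarrier_def)
  with W(2) have W_iff: "f y \<noteq> 0 \<longleftrightarrow> y \<in> W" if "y \<in> D" for y
    using that by auto
  have "x \<in> D" using x f0 by blast
  with W_iff x have "x \<in> W" "x \<in> units G" by (auto simp: D_def)
  then obtain K where K: "openin (gtop G) K" "compactin (gtop G) K" "x \<in> K" "K \<subseteq> W" "K \<subseteq> units G"
    by (rule compact_open_units_neighbourhood [OF W(1)])
  have KD: "K \<inter> D \<subseteq> gcarrier ?H"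
    using gdom_unit units_carrier by (auto simp: D_def)
  have "K \<inter> D = K \<inter> gcarrier ?H"
    using KD K(5) gdom_unit by auto
  then have KD_open: "openin (gtop ?H) (K \<inter> D)"
    using K(1) by (auto simp: openin_subtopology)
  have "K \<inter> D = K - ideal_support G I" using K(5) by (auto simp: D_def)
  moreover have "closedin (gtop G) (K - ideal_support G I)"
    using compactin_imp_closedin [OF Hausdorff K(2)] openin_ideal_support by (rule closedin_diff)
  ultimately have "compactin (gtop G) (K \<inter> D)"
    using closed_compactin [OF K(2)] by simp
  then have KD_compact: "compactin (gtop ?H) (K \<inter> D)"
    using KD by (auto simp: compactin_subtopology)
  \<comment> \<open>The product of this function with \<open>f\<close> is the indicator function of \<open>K \<inter> D\<close>, and it is continuous
    because \<open>f\<close> has no zeros on the clopen set \<open>K \<inter> D\<close>.\<close>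
  define g where "g y = (if y \<in> K \<inter> D then inverse (f y) else 0)" for y
  have "g \<in> Cc ?H"
  proof (rule Cc_clopen_support [OF _ KD_open KD_compact])
    show "Hausdorff_space (gtop ?H)" by (simp add: Hausdorff_space_subtopology Hausdorff)
    have "subtopology (gtop ?H) (K \<inter> D) = subtopology (unit_top ?H) (K \<inter> D)"
      using KD unfolding unit_top_H
      by (simp add: subtopology_subtopology inf.absorb2 inf.left_commute [of D])
    then have "continuous_map (subtopology (gtop ?H) (K \<inter> D)) euclidean f"
      using f_cont by (simp add: continuous_map_from_subtopology)
    then have "continuous_map (subtopology (gtop ?H) (K \<inter> D)) (top_of_set (- {0})) f"
      by (rule continuous_map_into_subtopology) (use W_iff K(4) in auto)
    moreover have "continuous_map (top_of_set (- {0})) euclidean (inverse :: complex \<Rightarrow> complex)"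
      by (auto intro!: continuous_intros)
    ultimately have "continuous_map (subtopology (gtop ?H) (K \<inter> D)) euclidean (inverse \<circ> f)"
      by (rule continuous_map_compose)
    then show "continuous_map (subtopology (gtop ?H) (K \<inter> D)) euclidean g"
      by (rule continuous_map_eq) (auto simp: g_def)
  qed (auto simp: g_def)
  obtain N where N: "\<And>y. cmod (g y) \<le> N" by (rule Cc_support [OF \<open>g \<in> Cc ?H\<close>]) blast
  let ?p = "reg_rep ?H (indicator (K \<inter> D))"
  have "reg_rep ?H g o\<^sub>L reg_rep ?H f = reg_rep ?H (\<lambda>y. g y * f y)"
    by (rule H.reg_rep_units_compose [where M = N and M' = M])
      (use M N f0 in \<open>auto simp: g_def units_H\<close>)
  also have "(\<lambda>y. g y * f y) = indicator (K \<inter> D)"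
    using W_iff K(4) by (auto simp: g_def fun_eq_iff split: split_indicator)
  finally have "?p \<in> ?L"
    using closed_idealD(6) [OF L reg_rep_Cc_in_Cstar_red [OF \<open>g \<in> Cc ?H\<close>] f(2)] by simp
  moreover have "?p o\<^sub>L ?p = ?p" by (rule H.reg_rep_indicator_idem) (simp add: units_H)
  ultimately have "?p \<in> \<psi> ` I" by (rule idempotent_in_closure_image [OF hom \<psi>(2) I closed])
  then obtain b where b: "b \<in> I" "\<psi> b = ?p" by auto
  let ?P = "reg_rep G (indicator K)"
  have P: "?P \<in> Cstar_red G" by (rule indicator_in_Cstar_red [OF K(1,2)])
  have "\<psi> ?P = reg_rep ?H (\<lambda>g. if g \<in> gcarrier ?H then indicator K g else 0)"
    using \<psi>(1) indicator_in_Cc [OF Hausdorff K(1,2)] unfolding restriction_hom_def by blast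
  also have "(\<lambda>g. if g \<in> gcarrier ?H then indicator K g else 0) = indicator (K \<inter> D)"
    using \<open>K \<inter> D = K \<inter> gcarrier ?H\<close> by (auto simp: fun_eq_iff split: split_indicator)
  finally have \<psi>P: "\<psi> ?P = ?p" .
  \<comment> \<open>Both the projection of \<open>K\<close> and \<open>b\<close> are mapped to the projection of \<open>K \<inter> D\<close>.\<close>
  have minus_b: "scaleC_op (-1) b \<in> I" by (rule I'(5) [OF b(1)])
  have "\<psi> (?P + scaleC_op (-1) b) = ?p + scaleC_op (-1) ?p"
    using hom P b minus_b I'(1) \<psi>P unfolding star_hom_def by (metis subsetD)
  then have "\<psi> (?P + scaleC_op (-1) b) = 0" by (simp add: scaleC_op_minus_one)
  moreover have "?P + scaleC_op (-1) b \<in> Cstar_red G"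
    using Cstar_red_add P minus_b I'(1) by blast
  ultimately have "?P + scaleC_op (-1) b \<in> I" using ker by blast
  from I'(4) [OF this b(1)] have "?P \<in> I" by (simp add: scaleC_op_minus_one)
  with K have "x \<in> ideal_support G I" unfolding ideal_support_def by blast
  with \<open>x \<in> D\<close> show False by (simp add: D_def)
qed

end

theorem corollary3p15:
  fixes G :: "'g groupoid"
  assumes "ample_groupoid G"
    and "inner_exact G"
    and "residual_intersection_property G"
  shows "ideal_property (Cstar_red G)"
proof -
  interpret ample_groupoid G by (fact assms(1))
  show ?thesis
    unfolding ideal_property_def
  proof (intro allI impI)
    fix I assume I: "closed_ideal (Cstar_red G) I"
    define U where "U = ideal_support G I"
    define D where "D = units G - U"
    have U: "units G - D = U" using ideal_support_units [of I] by (auto simp: D_def U_def)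
    have "invariant G D"
      unfolding D_def U_def by (rule invariant_ideal_support_compl [OF I])
    moreover have "closedin (unit_top G) D"
      using openin_ideal_support [of I] ideal_support_units [of I]
      by (simp add: closedin_def D_def U_def double_diff openin_unit_top)
    ultimately obtain \<phi> \<psi> where \<phi>: "extension_hom G U \<phi>" and \<psi>: "restriction_hom G D \<psi>"
      and exact: "short_exact (Cstar_red (reduction G U)) (Cstar_red G) (Cstar_red (reduction G D)) \<phi> \<psi>"
      and ip: "intersection_property (reduction G D)"
      using assms(2,3) U unfolding inner_exact_def residual_intersection_property_def by metis
    have ker: "{T \<in> Cstar_red G. \<psi> T = 0} \<subseteq> J"
      if "closed_ideal (Cstar_red G) J" "{P \<in> I. is_projection P} \<subseteq> J" for J
      using extension_image_subset [OF I that \<phi> [unfolded U_def]] exact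
      by (simp add: short_exact_def U_def)
    have "\<psi> ` I \<subseteq> {0}"
      using restriction_kills_ideal [OF I, of \<psi>] ip \<psi> ker [OF I] exact
      by (auto simp: short_exact_def D_def U_def)
    with closed_idealD(1) [OF I] have "I \<subseteq> {T \<in> Cstar_red G. \<psi> T = 0}" by blast
    with ker have "I \<subseteq> closed_ideal (Cstar_red G) hull {P \<in> I. is_projection P}"
      unfolding hull_def by blast
    moreover have "closed_ideal (Cstar_red G) hull {P \<in> I. is_projection P} \<subseteq> I"
      by (rule hull_minimal) (use I in auto)
    ultimately show "closed_ideal (Cstar_red G) hull {P \<in> I. is_projection P} = I"
      by blast
  qed
qed

end
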